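(* Let $X$ be a Hilbert space, $(\mathcal P,d_1)$ and $(\mathcal Q,d_2)$ metric spaces, $f\colon X\times\mathcal P\times\mathcal Q\to X$ a mapping, $g\colon X\times\mathcal P\to\overline{\mathbb R}$ a lower semicontinuous function, and let $\bar x\in S(\bar v,\bar p,\bar q)$, where $$S(v,p,q)=\{x\in X\mid v\in f(x,p,q)+\partial_xg(x,p)\}.$$ Put $\hat v:=\bar v-f(\bar x,\bar p,\bar q)$, assume that (A1)--(A3) (see context) are satisfied, and let $\mathcal R$ be the threshold of prox-regularity of $g$ at $(\bar x,\bar p)$ for $\hat v$. Assume that $f$ is locally strongly monotone in $x$ on some neighborhood $U\times P\times Q$ of $(\bar x,\bar p,\bar q)$ with modulus $\sigma>\mathcal R$, i.e. $$\langle f(x_1,p,q)-f(x_2,p,q),x_1-x_2\rangle\ge\sigma\|x_1-x_2\|^2\quad\text{for all }x_1,x_2\in U,\ (p,q)\in P\times Q,$$ and assume in addition that the set-valued mapping $K\colon p\mapsto\operatorname{gph}\partial_xg(\cdot,p)\subset X\times X$ is Lipschitz-like around $(\bar p,\bar x,\hat v)$. Then $\bar x$ is a Lipschitzian fully stable solution of $v\in f(x,p,q)+\partial_xg(x,p)$ corresponding to $(\bar v,\bar p,\bar q)$.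
   Context: Notation. $X$ is a real Hilbert space identified with its dual, $\overline{\mathbb R}=(-\infty,\infty]$, $\mathbb B$ is a closed unit ball. Generalized differentiation. For $\varphi\colon X\to\overline{\mathbb R}$ and $\varphi(\bar x)<\infty$, $\hat\partial\varphi(\bar x)=\{v\mid\liminf_{x\to\bar x}\frac{\varphi(x)-\varphi(\bar x)-\langle v,x-\bar x\rangle}{\|x-\bar x\|}\ge0\}$; the limiting subdifferential $\partial\varphi(\bar x)$ is the set of all $v$ for which there are $x_k\to\bar x$ with $\varphi(x_k)\to\varphi(\bar x)$ and $v_k\in\hat\partial\varphi(x_k)$ with $v_k\to v$ weakly. $\partial_xg(x,p)$ is the limiting subdifferential of $g(\cdot,p)$ at $x$, $\operatorname{gph}\partial_xg(\cdot,p)=\{(x,v)\mid v\in\partial_xg(x,p)\}$, and $\operatorname{gph}\partial_xg=\{(x,p,v)\mid v\in\partial_xg(x,p)\}$. Lipschitz-like. A set-valued mapping $F$ from a metric space $(M,d)$ to a normed space is Lipschitz-like around $(\bar m,\bar y)\in\operatorname{gph}F$ if there are $\ell>0$ and neighborhoods $U$ of $\bar m$, $V$ of $\bar y$ with $F(m)\cap V\subset F(m')+\ell d(m,m')\mathbb B$ for all $m,m'\in U$. Assumptions. (A1) There are $L>0$ and a neighborhood $U\times P\times Q$ of $(\bar x,\bar p,\bar q)$ on which $\|f(x_1,p_1,q_1)-f(x_2,p_2,q_2)\|\le L[\|x_1-x_2\|+d_1(p_1,p_2)+d_2(q_1,q_2)]$. (A2) $g$ is parametrically continuously prox-regular at $(\bar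 x,\bar p)$ for $\hat v$, i.e. (a) there are neighborhoods $U$ of $\bar x$, $V$ of $\hat v$, $P$ of $\bar p$ and $\varepsilon,r>0$ with $g(x,p)\ge g(u,p)+\langle v,x-u\rangle-\frac r2\|x-u\|^2$ for all $x\in U$ whenever $v\in\partial_xg(u,p)\cap V$, $u\in U$, $p\in P$, $g(u,p)\le g(\bar x,\bar p)+\varepsilon$; and (b) $(x,p,v)\mapsto g(x,p)$ is continuous relative to $\operatorname{gph}\partial_xg$ at $(\bar x,\bar p,\hat v)$. The infimum of all $r>0$ for which (a) holds (with some $U,V,P,\varepsilon$) is the threshold of prox-regularity $\mathcal R$ of $g$ at $(\bar x,\bar p)$ for $\hat v$. (A3) The mapping $p\mapsto\operatorname{epi}g(\cdot,p)$ is Lipschitz-like around $(\bar p,(\bar x,g(\bar x,\bar p)))$. Full stability. A single-valued localization of a set-valued mapping $F$ relative to a neighborhood $A\times B$ of a point of $\operatorname{gph}F$ is a single-valued mapping $\vartheta\colon A\to B$, defined on all of $A$, with $\operatorname{gph}\vartheta=\operatorname{gph}F\cap(A\times B)$. $\bar x$ is Lipschitzian fully stable corresponding to $(\bar v,\bar p,\bar q)$ if $S$ has a single-valued localization $\vartheta$ relative to some neighborhood $V\times P\times Q\times U$ of $(\bar v,\bar p,\bar q,\bar x)$ and there are $\kappa,\ell>0$ such that for all $(v_i,p_i,q_i)\in V\times P\times Q$, $i=1,2$, $$\|(v_1-v_2)-2\kappa[\vartheta(v_1,p_1,q_1)-\vartheta(v_2,p_2,q_2)]\|\le\|v_1-v_2\|+\ell[d_1(p_1,p_2)+d_2(q_1,q_2)].$$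 *)

theory Defs
  imports "HOL-Analysis.Analysis"
begin

section \<open>Set-valued mappings\<close>

definition gph :: "('a \<Rightarrow> 'b set) \<Rightarrow> ('a \<times> 'b) set"
  where "gph F = {(a, b). b \<in> F a}"

definition lipschitz_like ::
    "('m::metric_space \<Rightarrow> 'y::real_normed_vector set) \<Rightarrow> 'm \<Rightarrow> 'y \<Rightarrow> bool"
  where "lipschitz_like F m0 y0 \<longleftrightarrow>
    (m0, y0) \<in> gph F \<and>
    (\<exists>l>0. \<exists>U V. open U \<and> m0 \<in> U \<and> open V \<and> y0 \<in> V \<and>
       (\<forall>m\<in>U. \<forall>m'\<in>U. F m \<inter> V \<subseteq> {y + (l * dist m m') *\<^sub>R b | y b. y \<in> F m' \<and> b \<in> cball 0 1}))"

text \<open>The function \<open>\<theta>\<close> only matters on \<open>A\<close>; there it is total and, because of the graph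
  identity, takes its values in \<open>B\<close>.\<close>

definition single_valued_localization ::
    "('a \<Rightarrow> 'b set) \<Rightarrow> 'a set \<Rightarrow> 'b set \<Rightarrow> ('a \<Rightarrow> 'b) \<Rightarrow> bool"
  where "single_valued_localization F A B \<theta> \<longleftrightarrow>
    (\<lambda>a. (a, \<theta> a)) ` A = gph F \<inter> (A \<times> B)"


section \<open>Extended-real-valued functions and subdifferentials\<close>

text \<open>Functions into \<open>ereal\<close> are meant to omit the value \<open>-\<infinity>\<close>; this is assumed where needed.\<close>

definition lower_semicontinuous :: "('a::topological_space \<Rightarrow> ereal) \<Rightarrow> bool"
  where "lower_semicontinuous \<phi> \<longleftrightarrow> (\<forall>x. \<phi> x \<le> Liminf (at x) \<phi>)"

definition epi :: "('a \<Rightarrow> ereal) \<Rightarrow> ('a \<times> real) set"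
  where "epi \<phi> = {(x, \<alpha>). \<phi> x \<le> ereal \<alpha>}"

text \<open>Both subdifferentials are empty at points where \<open>\<phi>\<close> is infinite.\<close>

definition regular_subdiff :: "('a::real_inner \<Rightarrow> ereal) \<Rightarrow> 'a \<Rightarrow> 'a set"
  where "regular_subdiff \<phi> x = {v. \<phi> x < \<infinity> \<and>
    0 \<le> Liminf (at x) (\<lambda>y. (\<phi> y - \<phi> x - ereal (v \<bullet> (y - x))) / ereal (norm (y - x)))}"

definition weakly_converges :: "(nat \<Rightarrow> 'a::real_inner) \<Rightarrow> 'a \<Rightarrow> bool"
  where "weakly_converges vs v \<longleftrightarrow> (\<forall>y. (\<lambda>k. vs k \<bullet> y) \<longlonglongrightarrow> v \<bullet> y)"

definition limiting_subdiff :: "('a::real_inner \<Rightarrow> ereal) \<Rightarrow> 'a \<Rightarrow> 'a set"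
  where "limiting_subdiff \<phi> x = {v. \<phi> x < \<infinity> \<and>
    (\<exists>xs vs. xs \<longlonglongrightarrow> x \<and> (\<lambda>k. \<phi> (xs k)) \<longlonglongrightarrow> \<phi> x \<and>
       (\<forall>k. vs k \<in> regular_subdiff \<phi> (xs k)) \<and> weakly_converges vs v)}"

definition subdiff_x :: "('x::real_inner \<Rightarrow> 'p \<Rightarrow> ereal) \<Rightarrow> 'x \<Rightarrow> 'p \<Rightarrow> 'x set"
  where "subdiff_x g x p = limiting_subdiff (\<lambda>u. g u p) x"

definition gph_subdiff_x :: "('x::real_inner \<Rightarrow> 'p \<Rightarrow> ereal) \<Rightarrow> ('x \<times> 'p \<times> 'x) set"
  where "gph_subdiff_x g = {(x, p, v). v \<in> subdiff_x g x p}"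


section \<open>Parametric prox-regularity\<close>

definition prox_regular_with ::
    "('x::real_inner \<Rightarrow> 'p::metric_space \<Rightarrow> ereal) \<Rightarrow> 'x \<Rightarrow> 'p \<Rightarrow> 'x \<Rightarrow> real \<Rightarrow> bool"
  where "prox_regular_with g x0 p0 v0 r \<longleftrightarrow>
    (\<exists>U V P \<epsilon>. open U \<and> x0 \<in> U \<and> open V \<and> v0 \<in> V \<and> open P \<and> p0 \<in> P \<and> \<epsilon> > 0 \<and>
      (\<forall>u\<in>U. \<forall>p\<in>P. \<forall>v \<in> subdiff_x g u p \<inter> V. g u p \<le> g x0 p0 + ereal \<epsilon> \<longrightarrow>
        (\<forall>x\<in>U. g x p \<ge> g u p + ereal (v \<bullet> (x - u)) - ereal (r / 2 * (norm (x - u))\<^sup>2))))"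

definition param_cont_prox_regular ::
    "('x::real_inner \<Rightarrow> 'p::metric_space \<Rightarrow> ereal) \<Rightarrow> 'x \<Rightarrow> 'p \<Rightarrow> 'x \<Rightarrow> bool"
  where "param_cont_prox_regular g x0 p0 v0 \<longleftrightarrow>
    (\<exists>r>0. prox_regular_with g x0 p0 v0 r) \<and>
    continuous (at (x0, p0, v0) within gph_subdiff_x g) (\<lambda>(x, p, v). g x p)"

text \<open>An infimum of reals: meaningful when \<open>g\<close> is prox-regular at the point, since the set is then
  nonempty (and it is always bounded below by \<open>0\<close>).\<close>

definition prox_threshold ::
    "('x::real_inner \<Rightarrow> 'p::metric_space \<Rightarrow> ereal) \<Rightarrow> 'x \<Rightarrow> 'p \<Rightarrow> 'x \<Rightarrow> real"
  where "prox_threshold g x0 p0 v0 = Inf {r. r > 0 \<and> prox_regular_with g x0 p0 v0 r}"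


section \<open>Parametric variational systems\<close>

definition lipschitz_near ::
    "('x::real_normed_vector \<Rightarrow> 'p::metric_space \<Rightarrow> 'q::metric_space \<Rightarrow> 'x) \<Rightarrow>
      'x \<Rightarrow> 'p \<Rightarrow> 'q \<Rightarrow> bool"
  where "lipschitz_near f x0 p0 q0 \<longleftrightarrow>
    (\<exists>L>0. \<exists>U P Q. open U \<and> x0 \<in> U \<and> open P \<and> p0 \<in> P \<and> open Q \<and> q0 \<in> Q \<and>
      (\<forall>x1\<in>U. \<forall>x2\<in>U. \<forall>p1\<in>P. \<forall>p2\<in>P. \<forall>q1\<in>Q. \<forall>q2\<in>Q.
        norm (f x1 p1 q1 - f x2 p2 q2) \<le> L * (norm (x1 - x2) + dist p1 p2 + dist q1 q2)))"

definition locally_strongly_monotone ::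
    "('x::real_inner \<Rightarrow> 'p::metric_space \<Rightarrow> 'q::metric_space \<Rightarrow> 'x) \<Rightarrow>
      'x \<Rightarrow> 'p \<Rightarrow> 'q \<Rightarrow> real \<Rightarrow> bool"
  where "locally_strongly_monotone f x0 p0 q0 \<sigma> \<longleftrightarrow>
    (\<exists>U P Q. open U \<and> x0 \<in> U \<and> open P \<and> p0 \<in> P \<and> open Q \<and> q0 \<in> Q \<and>
      (\<forall>x1\<in>U. \<forall>x2\<in>U. \<forall>p\<in>P. \<forall>q\<in>Q.
        (f x1 p q - f x2 p q) \<bullet> (x1 - x2) \<ge> \<sigma> * (norm (x1 - x2))\<^sup>2))"

definition solution_map ::
    "('x::real_inner \<Rightarrow> 'p \<Rightarrow> 'q \<Rightarrow> 'x) \<Rightarrow> ('x \<Rightarrow> 'p \<Rightarrow> ereal) \<Rightarrow> 'x \<times> 'p \<times> 'q \<Rightarrow> 'x set"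
  where "solution_map f g = (\<lambda>(v, p, q). {x. v \<in> (\<lambda>w. f x p q + w) ` subdiff_x g x p})"

definition lipschitzian_fully_stable ::
    "('x::real_inner \<Rightarrow> 'p::metric_space \<Rightarrow> 'q::metric_space \<Rightarrow> 'x) \<Rightarrow> ('x \<Rightarrow> 'p \<Rightarrow> ereal) \<Rightarrow>
      'x \<Rightarrow> 'x \<Rightarrow> 'p \<Rightarrow> 'q \<Rightarrow> bool"
  where "lipschitzian_fully_stable f g x0 v0 p0 q0 \<longleftrightarrow>
    ((v0, p0, q0), x0) \<in> gph (solution_map f g) \<and>
    (\<exists>V P Q U \<theta>. open V \<and> v0 \<in> V \<and> open P \<and> p0 \<in> P \<and> open Q \<and> q0 \<in> Q \<and> open U \<and> x0 \<in> U \<and>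
      single_valued_localization (solution_map f g) (V \<times> P \<times> Q) U \<theta> \<and>
      (\<exists>\<kappa>>0. \<exists>l>0. \<forall>v1\<in>V. \<forall>v2\<in>V. \<forall>p1\<in>P. \<forall>p2\<in>P. \<forall>q1\<in>Q. \<forall>q2\<in>Q.
        norm ((v1 - v2) - (2 * \<kappa>) *\<^sub>R (\<theta> (v1, p1, q1) - \<theta> (v2, p2, q2)))
          \<le> norm (v1 - v2) + l * (dist p1 p2 + dist q1 q2)))"

end

theory Submission
  imports Defs
begin

text \<open>
  Fix a modulus \<open>r < \<sigma>\<close> for which the inequality of prox-regularity holds. On a small ball around \<open>(xbar, vhat)\<close>, prox-regularity makes the
  subdifferential \<open>T\<^sub>p = \<partial>\<^sub>x g(\<cdot>, p)\<close> hypomonotone with modulus \<open>r\<close>, uniformly in \<open>p\<close>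
  (\<open>prox_regular_on_uniformly\<close>, \<open>prox_regular_on_hypomonotone\<close>). Hence \<open>f(\<cdot>, p, q) + T\<^sub>p\<close> is
  strongly monotone there with modulus \<open>\<kappa> = \<sigma> - r > 0\<close>. Strong monotonicity says precisely that two
  solutions \<open>x\<^sub>1, x\<^sub>2\<close> for the same \<open>(p, q)\<close> and right-hand sides \<open>v\<^sub>1, v\<^sub>2\<close> satisfy
  \<open>\<parallel>(v\<^sub>1 - v\<^sub>2) - 2\<kappa>(x\<^sub>1 - x\<^sub>2)\<parallel> \<le> \<parallel>v\<^sub>1 - v\<^sub>2\<parallel>\<close>. To compare solutions for different parameters, the
  Lipschitz-like property of \<open>K\<close> moves \<open>(x\<^sub>1, v\<^sub>1 - f(x\<^sub>1, p\<^sub>1, q\<^sub>1))\<close> from the graph of \<open>T\<^bsub>p\<^sub>1\<^esub>\<close> to a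
  point of the graph of \<open>T\<^bsub>p\<^sub>2\<^esub>\<close> at a distance of order \<open>d(p\<^sub>1, p\<^sub>2)\<close>; by the Lipschitz continuity
  of \<open>f\<close>, this point solves the equation for \<open>(p\<^sub>2, q\<^sub>2)\<close> with a right-hand side close to \<open>v\<^sub>1\<close>, and
  the triangle inequality gives the estimate of full stability. Uniqueness is the case of equal
  parameters.

  What remains is existence, on a neighborhood whose size does not depend on the parameters. The
  Lipschitz-like property of \<open>K\<close> provides, for each \<open>p\<close> near \<open>pbar\<close>, a point \<open>(x\<^sub>p, v\<^sub>p)\<close> of the graph
  of \<open>T\<^sub>p\<close> near \<open>(xbar, vhat)\<close>. Prox-regularity at that point gives \<open>g(\<cdot>, p)\<close> a quadratic minorant
  touching at \<open>x\<^sub>p\<close>. So for \<open>\<mu> > r\<close> and \<open>w\<close> near \<open>v\<^sub>p\<close> the function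
  \<open>g(\<cdot>, p) + \<mu>/2 \<parallel>\<cdot> - x\<^sub>p\<parallel>\<^sup>2 - \<langle>w, \<cdot> - x\<^sub>p\<rangle>\<close> has its almost-minimizers close to \<open>x\<^sub>p\<close>. Minimizers
  cannot be obtained by weak compactness, because \<open>g(\<cdot>, p)\<close> is only norm lower semicontinuous; the
  variational principle of Borwein and Preiss (\<open>quadratic_variational_principle\<close>) yields exact
  minimizers of slightly perturbed functions, and hypomonotonicity makes these minimizers a Cauchy
  sequence. Its limit \<open>z\<close> satisfies \<open>w - \<mu>(z - x\<^sub>p) \<in> T\<^sub>p(z)\<close> (\<open>localized_resolvent\<close>). Writing
  \<open>J\<close> for the map \<open>w \<mapsto> z\<close>, the solutions of \<open>v \<in> f(x, p, q) + T\<^sub>p(x)\<close> are the fixed points of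
  \<open>x \<mapsto> J(v - f(x, p, q) + \<mu>(x - x\<^sub>p))\<close>. The map \<open>J\<close> is Lipschitz with constant \<open>1/(\<mu> - r)\<close>, and the
  squared Lipschitz constant of \<open>\<mu> x - f(x, p, q)\<close> is at most \<open>\<mu>\<^sup>2 - 2\<mu>\<sigma> + L\<^sup>2\<close>. Since \<open>\<sigma> > r\<close>, the
  composition is a contraction as soon as \<open>\<mu>\<close> is large, and Banach's fixed point theorem
  applies (\<open>generalized_equation_solvable\<close>).
\<close>

section \<open>A variational principle with quadratic perturbations\<close>

text \<open>Comparing the almost-minimizer with the given point, and keeping the better of the two, costs
  nothing; it makes the values along the iteration below decrease.\<close>

lemma approximate_minimizer_below:
  fixes h :: "'a \<Rightarrow> real"
  assumes "x \<in> S" and bd: "\<And>y. y \<in> S \<Longrightarrow> m \<le> h y" and "\<epsilon> > 0"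
  shows "\<exists>a\<in>S. h a \<le> h x \<and> (\<forall>y\<in>S. h a \<le> h y + \<epsilon>)"
proof -
  have bdd: "bdd_below (h ` S)"
    by (rule bdd_belowI2[OF bd])
  have "Inf (h ` S) < Inf (h ` S) + \<epsilon>" using \<open>\<epsilon> > 0\<close> by simp
  then obtain b where b: "b \<in> S" "h b < Inf (h ` S) + \<epsilon>"
    using cInf_lessD[of "h ` S" "Inf (h ` S) + \<epsilon>"] \<open>x \<in> S\<close> by auto
  have b2: "h b \<le> h y + \<epsilon>" if "y \<in> S" for y
    using cInf_lower[OF _ bdd, of "h y"] that b(2) by fastforce
  show ?thesis
  proof (cases "h b \<le> h x")
    case True
    then show ?thesis using b(1) b2 by blast
  next
    case False
    then have "h x \<le> h y + \<epsilon>" if "y \<in> S" for y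
      using b2[OF that] by simp
    then show ?thesis using \<open>x \<in> S\<close> by blast
  qed
qed

lemma norm_sq_expand:
  fixes x y z :: "'a::real_inner"
  shows "(norm (x - y))\<^sup>2 = (norm (z - y))\<^sup>2 + 2 * ((z - y) \<bullet> (x - z)) + (norm (x - z))\<^sup>2"
proof -
  have "x - y = (z - y) + (x - z)" by simp
  then show ?thesis
    by (simp only: power2_norm_eq_inner inner_add_left inner_add_right)
      (simp add: inner_commute)
qed

text \<open>
  The Borwein--Preiss principle, stated through the subgradient that it produces. Starting from
  \<open>h\<^sub>0 = F\<close>, almost minimize \<open>h\<^sub>n\<close> at \<open>x\<^sub>n\<close> and put \<open>h\<^bsub>n+1\<^esub> = h\<^sub>n + \<delta>\<^sub>n \<parallel>\<cdot> - x\<^sub>n\<parallel>\<^sup>2\<close>. The sublevel sets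
  \<open>N n\<close> of \<open>h\<^bsub>n+1\<^esub>\<close> at height \<open>h\<^sub>n(x\<^sub>n)\<close> are nested, and they shrink because the tolerance of step
  \<open>n\<close> is much smaller than \<open>\<delta>\<^sub>n\<close>. Their common point \<open>z\<close> minimizes \<open>F\<close> plus the sum of all the added
  squares, and the expansion of these squares around \<open>z\<close> leaves a linear term \<open>e\<close> and one multiple
  of \<open>\<parallel>\<cdot> - z\<parallel>\<^sup>2\<close>. Closedness of the epigraph over \<open>S\<close> expresses at once that \<open>F\<close> is lower
  semicontinuous and that its sublevel sets are closed in the whole space, so \<open>S\<close> may be the
  non-closed domain of an extended-real function.
\<close>

theorem quadratic_variational_principle:
  fixes F :: "'a::{real_inner, complete_space} \<Rightarrow> real"
  assumes cl: "closed {(x, c). x \<in> S \<and> F x \<le> c}"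
    and bd: "\<And>x. x \<in> S \<Longrightarrow> m \<le> F x"
    and a: "a \<in> S" and \<epsilon>: "\<epsilon> > 0"
  obtains z e where "z \<in> S" "F z \<le> F a" "norm e \<le> \<epsilon>"
    "\<And>x. x \<in> S \<Longrightarrow> F z + e \<bullet> (x - z) - \<epsilon> * (norm (x - z))\<^sup>2 \<le> F x"
proof -
  \<comment> \<open>The weights sum up to \<open>\<epsilon> / 2\<close>, and a point of the \<open>n\<close>-th sublevel set has distance at most
    \<open>2\<^sup>-\<^sup>n\<close> to \<open>x\<^sub>n\<close> because the tolerance is \<open>\<delta>\<^sub>n (2\<^sup>-\<^sup>n)\<^sup>2\<close>.\<close>
  define \<delta> where "\<delta> n = \<epsilon> / 2 * (1/2) ^ Suc n" for n :: nat
  have \<delta>pos: "\<delta> n > 0" for n using \<epsilon> by (simp add: \<delta>_def)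
  have "(\<lambda>n. \<epsilon> / 2 * (1/2) ^ Suc n) sums (\<epsilon> / 2 * 1)"
    by (intro sums_mult power_half_series)
  then have \<delta>sums: "\<delta> sums (\<epsilon> / 2)"
    by (simp add: \<delta>_def[abs_def])
  define tol where "tol n = \<delta> n * ((1/2) ^ n)\<^sup>2" for n :: nat
  have tolpos: "tol n > 0" for n using \<delta>pos by (simp add: tol_def)

  \<comment> \<open>The state of step \<open>n\<close> is the pair of the perturbed function \<open>h\<^sub>n\<close> and the point \<open>x\<^sub>n\<close>, since
    \<open>h\<^sub>n\<close> depends on all earlier points.\<close>
  define P where "P n s \<longleftrightarrow> snd s \<in> S \<and> fst s (snd s) \<le> F a \<and> (\<forall>y\<in>S. m \<le> fst s y) \<and>
      (\<forall>y\<in>S. fst s (snd s) \<le> fst s y + tol n) \<and> (n = 0 \<longrightarrow> fst s = F)"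
    for n and s :: "('a \<Rightarrow> real) \<times> 'a"
  define Q where "Q n s t \<longleftrightarrow> fst t = (\<lambda>y. fst s y + \<delta> n * (norm (y - snd s))\<^sup>2) \<and>
      fst t (snd t) \<le> fst s (snd s)"
    for n and s t :: "('a \<Rightarrow> real) \<times> 'a"
  have "\<exists>st. \<forall>n. P n (st n) \<and> Q n (st n) (st (Suc n))"
  proof (rule dependent_nat_choice)
    obtain x where "x \<in> S" "F x \<le> F a" "\<forall>y\<in>S. F x \<le> F y + tol 0"
      using approximate_minimizer_below[where h = F, OF a bd tolpos] by blast
    then show "\<exists>s. P 0 s"
      using bd by (intro exI[of _ "(F, x)"]) (auto simp: P_def)
  next
    fix s n assume s: "P n s"
    define h where "h = (\<lambda>y. fst s y + \<delta> n * (norm (y - snd s))\<^sup>2)"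
    have m: "m \<le> h y" if "y \<in> S" for y
    proof -
      have "m \<le> fst s y" using s that by (simp add: P_def)
      moreover have "0 \<le> \<delta> n * (norm (y - snd s))\<^sup>2"
        using \<delta>pos[of n] by simp
      ultimately show ?thesis by (simp add: h_def)
    qed
    have hs: "h (snd s) = fst s (snd s)" by (simp add: h_def)
    obtain x where x: "x \<in> S" "h x \<le> h (snd s)" "\<forall>y\<in>S. h x \<le> h y + tol (Suc n)"
      using approximate_minimizer_below[where h = h, OF _ m tolpos] s unfolding P_def by blast
    then show "\<exists>t. P (Suc n) t \<and> Q n s t"
      using s m hs by (intro exI[of _ "(h, x)"]) (auto simp: P_def Q_def h_def)
  qed
  then obtain st where st: "\<And>n. P n (st n)" "\<And>n. Q n (st n) (st (Suc n))" by blast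
  define h where "h n = fst (st n)" for n
  define x where "x n = snd (st n)" for n
  have xS: "x n \<in> S" and hx: "h n (x n) \<le> F a"
    and appr: "\<And>y. y \<in> S \<Longrightarrow> h n (x n) \<le> h n y + tol n" for n
    using st(1)[of n] by (auto simp: P_def h_def x_def)
  have h0: "h 0 = F" using st(1)[of 0] by (simp add: P_def h_def)
  have hSuc: "h (Suc n) y = h n y + \<delta> n * (norm (y - x n))\<^sup>2"
    and dec: "h (Suc n) (x (Suc n)) \<le> h n (x n)" for n y
    using st(2)[of n] by (auto simp: Q_def h_def x_def)
  have hsum: "h n y = F y + (\<Sum>i<n. \<delta> i * (norm (y - x i))\<^sup>2)" for n y
    by (induction n) (auto simp: h0 hSuc)

  define N where "N n = {y\<in>S. h (Suc n) y \<le> h n (x n)}" for n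
  have close: "norm (y - x n) \<le> (1/2) ^ n" if "y \<in> N n" for y n
  proof -
    have y: "y \<in> S" "h n y + \<delta> n * (norm (y - x n))\<^sup>2 \<le> h n (x n)"
      using that by (auto simp: N_def hSuc)
    have "\<delta> n * (norm (y - x n))\<^sup>2 \<le> \<delta> n * ((1/2) ^ n)\<^sup>2"
      using y(2) appr[OF y(1), of n] by (simp add: tol_def)
    then have "(norm (y - x n))\<^sup>2 \<le> ((1/2) ^ n)\<^sup>2"
      using \<delta>pos by simp
    then show ?thesis by (rule power2_le_imp_le) simp
  qed
  have nested: "N (Suc n) \<subseteq> N n" for n
  proof
    fix y assume "y \<in> N (Suc n)"
    then have y: "y \<in> S" "h (Suc n) y + \<delta> (Suc n) * (norm (y - x (Suc n)))\<^sup>2 \<le> h (Suc n) (x (Suc n))"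
      by (auto simp: N_def hSuc)
    have "0 \<le> \<delta> (Suc n) * (norm (y - x (Suc n)))\<^sup>2" using \<delta>pos[of "Suc n"] by simp
    then have "h (Suc n) y \<le> h n (x n)" using y(2) dec[of n] by linarith
    then show "y \<in> N n" using y(1) by (simp add: N_def)
  qed
  have antimono: "N k \<subseteq> N n" if "n \<le> k" for n k
    using that by (induction rule: dec_induct) (use nested in blast)+
  have xN: "x k \<in> N n" if "n \<le> k" for n k
  proof -
    have "x k \<in> N k" using xS by (simp add: N_def hSuc)
    then show ?thesis using antimono[OF that] by blast
  qed
  have half: "(\<lambda>n. (1/2 :: real) ^ n) \<longlonglongrightarrow> 0"
    by (intro LIMSEQ_realpow_zero) auto
  have "Cauchy x"
  proof (rule metric_CauchyI)
    fix d :: real assume "d > 0"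
    then obtain M where M: "(1/2 :: real) ^ M < d / 2"
      using order_tendstoD(2)[OF half, of "d/2"] by (auto simp: eventually_sequentially)
    have "dist (x j) (x k) < d" if "j \<ge> M" "k \<ge> M" for j k
    proof -
      have "dist (x j) (x M) \<le> (1/2) ^ M" "dist (x k) (x M) \<le> (1/2) ^ M"
        using close[OF xN[OF that(1)]] close[OF xN[OF that(2)]] by (auto simp: dist_norm)
      then show ?thesis using M dist_triangle2[of "x j" "x k" "x M"] by linarith
    qed
    then show "\<exists>M. \<forall>j\<ge>M. \<forall>k\<ge>M. dist (x j) (x k) < d" by blast
  qed
  then obtain z where z: "x \<longlonglongrightarrow> z"
    using Cauchy_convergent convergent_def by blast
  \<comment> \<open>The points \<open>(x\<^sub>k, h\<^sub>n(x\<^sub>n) - q(x\<^sub>k))\<close> lie on the closed epigraph, where \<open>q\<close> is the continuous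
    perturbation contained in \<open>h\<^bsub>n+1\<^esub>\<close>.\<close>
  have zN: "z \<in> N n" for n
  proof -
    define q where "q y = (\<Sum>i<Suc n. \<delta> i * (norm (y - x i))\<^sup>2)" for y
    have lim: "(\<lambda>k. (x (k + n), h n (x n) - q (x (k + n)))) \<longlonglongrightarrow> (z, h n (x n) - q z)"
      unfolding q_def by (intro tendsto_intros LIMSEQ_ignore_initial_segment[OF z])
    have "(x (k + n), h n (x n) - q (x (k + n))) \<in> {(x, c). x \<in> S \<and> F x \<le> c}" for k
      using xN[of n "k + n"] by (simp add: N_def hsum[of "Suc n"] q_def)
    then have "(z, h n (x n) - q z) \<in> {(x, c). x \<in> S \<and> F x \<le> c}"
      using closed_sequentially[OF cl _ lim] by blast
    then show ?thesis by (simp add: N_def hsum[of "Suc n"] q_def)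
  qed

  \<comment> \<open>\<open>2 t\<^sub>i\<close> is the negative gradient at \<open>z\<close> of the \<open>i\<close>-th added square. Their partial
    sums are dominated by those of \<open>\<delta>\<close>, and completeness sums the series.\<close>
  define t where "t i = \<delta> i *\<^sub>R (x i - z)" for i
  have tle: "norm (t i) \<le> \<delta> i" for i
  proof -
    have "norm (x i - z) \<le> (1/2) ^ i"
      using close[OF zN[of i]] by (simp add: norm_minus_commute)
    also have "\<dots> \<le> 1" by (simp add: power_le_one)
    finally have "\<delta> i * norm (x i - z) \<le> \<delta> i * 1"
      using \<delta>pos[of i] by (intro mult_left_mono) auto
    then show ?thesis using \<delta>pos[of i] by (simp add: t_def)
  qed
  have "Cauchy (\<lambda>n. \<Sum>i<n. t i)"
  proof (rule metric_CauchyI)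
    fix d :: real assume "d > 0"
    have "Cauchy (\<lambda>n. \<Sum>i<n. \<delta> i)"
      using \<delta>sums by (auto simp: sums_def intro: LIMSEQ_imp_Cauchy)
    then obtain M where M: "\<And>j k. j \<ge> M \<Longrightarrow> k \<ge> M \<Longrightarrow> dist (\<Sum>i<j. \<delta> i) (\<Sum>i<k. \<delta> i) < d"
      using \<open>d > 0\<close> unfolding Cauchy_def by blast
    have le: "norm ((\<Sum>i<k. t i) - (\<Sum>i<j. t i)) \<le> (\<Sum>i<k. \<delta> i) - (\<Sum>i<j. \<delta> i)" if "j \<le> k" for j k
      using that
    proof (induction rule: dec_induct)
      case (step k)
      have "norm (((\<Sum>i<k. t i) - (\<Sum>i<j. t i)) + t k) \<le> ((\<Sum>i<k. \<delta> i) - (\<Sum>i<j. \<delta> i)) + \<delta> k"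
        by (rule norm_triangle_le) (use step.IH tle[of k] in linarith)
      then show ?case by (simp add: algebra_simps)
    qed simp
    have d: "dist (\<Sum>i<k. t i) (\<Sum>i<j. t i) < d" if "j \<le> k" "j \<ge> M" for j k
    proof -
      have "k \<ge> M" using that by simp
      then show ?thesis
        using le[OF that(1)] M[OF _ that(2), of k] by (simp add: dist_norm)
    qed
    have "dist (\<Sum>i<j. t i) (\<Sum>i<k. t i) < d" if "j \<ge> M" "k \<ge> M" for j k
      using d[of j k] d[of k j] that by (cases "j \<le> k") (auto simp: dist_commute)
    then show "\<exists>M. \<forall>j\<ge>M. \<forall>k\<ge>M. dist (\<Sum>i<j. t i) (\<Sum>i<k. t i) < d" by blast
  qed
  then obtain T where T: "(\<lambda>n. \<Sum>i<n. t i) \<longlonglongrightarrow> T"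
    using Cauchy_convergent convergent_def by blast
  define e where "e = 2 *\<^sub>R T"
  have "norm (\<Sum>i<n. t i) \<le> (\<Sum>i<n. \<delta> i)" for n
    by (rule sum_norm_le) (rule tle)
  then have "norm T \<le> \<epsilon> / 2"
    by (intro LIMSEQ_le[OF tendsto_norm[OF T] \<delta>sums[unfolded sums_def]]) auto
  then have e: "norm e \<le> \<epsilon>"
    by (simp add: e_def)
  have "F z + e \<bullet> (y - z) - \<epsilon> * (norm (y - z))\<^sup>2 \<le> F y" if y: "y \<in> S" for y
  proof (cases "y = z")
    case False
    \<comment> \<open>A point other than \<open>z\<close> leaves the shrinking sets \<open>N n\<close>, and from then on
      \<open>h\<^bsub>n+1\<^esub>(z) \<le> h\<^sub>n(x\<^sub>n) < h\<^bsub>n+1\<^esub>(y)\<close>.\<close>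
    have "\<exists>n. y \<notin> N n"
    proof (rule ccontr)
      assume "\<not> ?thesis"
      then have "norm (y - x n) \<le> (1/2) ^ n" for n using close by blast
      then have "(\<lambda>n. x n - y) \<longlonglongrightarrow> 0"
        by (intro Lim_null_comparison[OF _ half]) (auto simp: norm_minus_commute)
      then have "x \<longlonglongrightarrow> y" by (simp add: LIM_zero_iff)
      then show False using z False LIMSEQ_unique by blast
    qed
    then obtain M where M: "y \<notin> N M" by blast
    have ev: "F z + 2 * ((\<Sum>i<Suc n. t i) \<bullet> (y - z)) - (\<Sum>i<Suc n. \<delta> i) * (norm (y - z))\<^sup>2 \<le> F y"
      if "n \<ge> M" for n
    proof -
      have "y \<notin> N n" using antimono[OF that] M by blast
      then have "h n (x n) \<le> h (Suc n) y" using y by (simp add: N_def)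
      moreover have "h (Suc n) z \<le> h n (x n)" using zN[of n] by (simp add: N_def)
      ultimately have le: "h (Suc n) z \<le> h (Suc n) y" by linarith
      have "\<delta> i * (norm (y - x i))\<^sup>2 = \<delta> i * (norm (z - x i))\<^sup>2 - 2 * (t i \<bullet> (y - z))
          + \<delta> i * (norm (y - z))\<^sup>2" for i
        by (simp add: norm_sq_expand[of y "x i" z] t_def algebra_simps inner_diff_left)
      then have "(\<Sum>i<Suc n. \<delta> i * (norm (y - x i))\<^sup>2) = (\<Sum>i<Suc n. \<delta> i * (norm (z - x i))\<^sup>2)
          - 2 * ((\<Sum>i<Suc n. t i) \<bullet> (y - z)) + (\<Sum>i<Suc n. \<delta> i) * (norm (y - z))\<^sup>2"
        by (simp only: sum.distrib sum_subtractf sum_distrib_left sum_distrib_right inner_sum_left)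
      then show ?thesis using le unfolding hsum by linarith
    qed
    have "(\<lambda>n. F z + 2 * ((\<Sum>i<Suc n. t i) \<bullet> (y - z)) - (\<Sum>i<Suc n. \<delta> i) * (norm (y - z))\<^sup>2)
       \<longlonglongrightarrow> F z + 2 * (T \<bullet> (y - z)) - (\<epsilon> / 2) * (norm (y - z))\<^sup>2"
      by (intro tendsto_intros LIMSEQ_Suc[OF T]
          LIMSEQ_Suc[OF \<delta>sums[unfolded sums_def]])
    then have "F z + 2 * (T \<bullet> (y - z)) - (\<epsilon> / 2) * (norm (y - z))\<^sup>2 \<le> F y"
      by (rule LIMSEQ_le_const2) (use ev in blast)
    moreover have "(\<epsilon> / 2) * (norm (y - z))\<^sup>2 \<le> \<epsilon> * (norm (y - z))\<^sup>2"
      using \<epsilon> by (intro mult_right_mono) auto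
    ultimately show ?thesis by (simp add: e_def)
  qed simp
  moreover have "F z \<le> F a"
  proof -
    have "F z + \<delta> 0 * (norm (z - x 0))\<^sup>2 \<le> F (x 0)"
      using zN[of 0] by (simp add: N_def hSuc h0)
    moreover have "0 \<le> \<delta> 0 * (norm (z - x 0))\<^sup>2" using \<delta>pos[of 0] by simp
    ultimately show ?thesis using hx[of 0] by (simp add: h0)
  qed
  moreover have "z \<in> S" using zN[of 0] by (simp add: N_def)
  ultimately show thesis using that e by blast
qed

section \<open>Subgradients of prox-regular functions\<close>

lemma lower_semicontinuous_closed_epi:
  assumes "lower_semicontinuous \<phi>"
  shows "closed (epi \<phi>)"
  unfolding closed_def
proof (subst open_subopen, intro ballI)
  fix s assume "s \<in> - epi \<phi>"
  then obtain x c where s: "s = (x, c)" and "ereal c < \<phi> x"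
    by (cases s) (auto simp: epi_def)
  then obtain c' where c': "ereal c < ereal c'" "ereal c' < \<phi> x"
    using ereal_dense2 by blast
  have "ereal c' < Liminf (at x) \<phi>"
    using c'(2) assms unfolding lower_semicontinuous_def by (meson less_le_trans)
  then have "eventually (\<lambda>y. ereal c' < \<phi> y) (at x)"
    using less_LiminfD by blast
  then obtain A where A: "open A" "x \<in> A" "\<And>y. y \<in> A \<Longrightarrow> y \<noteq> x \<Longrightarrow> ereal c' < \<phi> y"
    unfolding eventually_at_topological by blast
  have "A \<times> {..<c'} \<subseteq> - epi \<phi>"
  proof
    fix b assume "b \<in> A \<times> {..<c'}"
    then obtain y d where b: "b = (y, d)" "y \<in> A" "d < c'" by blast
    then have "ereal c' < \<phi> y" using A(3) c'(2) by (cases "y = x") auto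
    moreover have "ereal d < ereal c'" using b(3) by simp
    ultimately have "ereal d < \<phi> y" by (rule less_trans[rotated])
    then show "b \<in> - epi \<phi>" by (simp add: b(1) epi_def)
  qed
  moreover have "open (A \<times> {..<c'})" "s \<in> A \<times> {..<c'}"
    using A c'(1) by (auto simp: s intro: open_Times)
  ultimately show "\<exists>T. open T \<and> s \<in> T \<and> T \<subseteq> - epi \<phi>" by blast
qed

lemma closed_epi_section:
  assumes "lower_semicontinuous (\<lambda>(x, p). g x p)"
  shows "closed (epi (\<lambda>x. g x p))"
proof -
  have "epi (\<lambda>x. g x p) = (\<lambda>(x, c). ((x, p), c)) -` epi (\<lambda>(x, p). g x p)"
    by (auto simp: epi_def)
  moreover have "continuous_on UNIV (\<lambda>(x, c). ((x, p), c))"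
    by (auto simp: split_beta intro!: continuous_intros)
  ultimately show ?thesis
    using closed_vimage[OF lower_semicontinuous_closed_epi[OF assms]] by simp
qed

lemma regular_subdiff_subset_limiting: "regular_subdiff \<phi> x \<subseteq> limiting_subdiff \<phi> x"
proof
  fix v assume v: "v \<in> regular_subdiff \<phi> x"
  then have "\<phi> x < \<infinity>" by (simp add: regular_subdiff_def)
  moreover have "(\<lambda>_. x) \<longlonglongrightarrow> x" "(\<lambda>_. \<phi> x) \<longlonglongrightarrow> \<phi> x"
    "weakly_converges (\<lambda>_. v) v"
    by (simp_all add: weakly_converges_def)
  ultimately have "\<exists>vs. (\<lambda>_. x) \<longlonglongrightarrow> x \<and> (\<lambda>_. \<phi> x) \<longlonglongrightarrow> \<phi> x \<and>
      (\<forall>k::nat. vs k \<in> regular_subdiff \<phi> x) \<and> weakly_converges vs v"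
    using v by (intro exI[of _ "\<lambda>_. v"]) simp
  then show "v \<in> limiting_subdiff \<phi> x"
    using \<open>\<phi> x < \<infinity>\<close> unfolding limiting_subdiff_def mem_Collect_eq
    by - (rule conjI, assumption, rule exI[of _ "\<lambda>_. x"], assumption)
qed

lemma proximal_subgradient_regular:
  fixes \<phi> :: "'a::real_inner \<Rightarrow> ereal"
  assumes fin: "\<phi> x = ereal a" and d: "d > 0"
    and le: "\<And>y. norm (y - x) < d \<Longrightarrow> ereal (a + v \<bullet> (y - x) - C * (norm (y - x))\<^sup>2) \<le> \<phi> y"
  shows "v \<in> regular_subdiff \<phi> x"
proof -
  let ?q = "\<lambda>y. (\<phi> y - \<phi> x - ereal (v \<bullet> (y - x))) / ereal (norm (y - x))"
  have "eventually (\<lambda>y. c < ?q y) (at x)" if c: "c < 0" for c :: ereal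
  proof -
    obtain b where b: "c < ereal b" "ereal b < 0" using ereal_dense2[OF c] by blast
    then have "b < 0" by simp
    have lim: "((\<lambda>y. - C * norm (y - x)) \<longlongrightarrow> - C * norm (x - x)) (at x)"
      by (intro tendsto_intros)
    have "eventually (\<lambda>y. b < - C * norm (y - x)) (at x)"
      using order_tendstoD(1)[OF lim, of b] \<open>b < 0\<close> by simp
    moreover have "eventually (\<lambda>y. dist y x < d) (at x)"
      using d by (auto simp: eventually_at)
    moreover have "eventually (\<lambda>y. y \<noteq> x) (at x)" by (simp add: eventually_at_filter)
    ultimately show ?thesis
    proof eventually_elim
      case (elim y)
      define n where "n = norm (y - x)"
      have n: "n > 0" using elim by (simp add: n_def)
      have "ereal (a + v \<bullet> (y - x) - C * n\<^sup>2) \<le> \<phi> y"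
        using le[of y] elim(2) by (simp add: dist_norm n_def)
      then have "ereal (- C * n) \<le> ?q y"
      proof (cases "\<phi> y")
        case (real t)
        then have "a + v \<bullet> (y - x) - C * n\<^sup>2 \<le> t"
          using \<open>ereal _ \<le> \<phi> y\<close> by simp
        then have "- C * n \<le> (t - a - v \<bullet> (y - x)) / n"
          using n by (simp add: field_simps power2_eq_square)
        then show ?thesis using real fin n by (simp add: n_def[symmetric])
      next
        case PInf
        then show ?thesis using fin n by (simp add: n_def[symmetric])
      next
        case MInf
        then show ?thesis using \<open>ereal _ \<le> \<phi> y\<close> by simp
      qed
      moreover have "ereal b < ereal (- C * n)" using elim(1) by (simp add: n_def)
      ultimately show ?case using b(1) by (meson less_le_trans less_trans)
    qed
  qed
  then have "0 \<le> Liminf (at x) ?q" by (simp add: le_Liminf_iff)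
  then show ?thesis by (simp add: regular_subdiff_def fin)
qed

text \<open>The inequality of prox-regularity for one function and fixed neighborhoods: for a family it is
  required with the same \<open>U\<close>, \<open>V\<close> and \<open>r\<close> for all nearby parameters.\<close>

definition prox_regular_on :: "('a::real_inner \<Rightarrow> ereal) \<Rightarrow> 'a set \<Rightarrow> 'a set \<Rightarrow> real \<Rightarrow> bool"
  where "prox_regular_on \<phi> U V r \<longleftrightarrow>
    (\<forall>u\<in>U. \<forall>v \<in> limiting_subdiff \<phi> u \<inter> V. \<forall>x\<in>U.
      \<phi> x \<ge> \<phi> u + ereal (v \<bullet> (x - u)) - ereal (r / 2 * (norm (x - u))\<^sup>2))"

lemma prox_regular_on_subset:
  assumes "prox_regular_on \<phi> U V r" "U' \<subseteq> U" "V' \<subseteq> V"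
  shows "prox_regular_on \<phi> U' V' r"
  using assms unfolding prox_regular_on_def by blast

lemma limiting_subdiff_finite:
  assumes "v \<in> limiting_subdiff \<phi> u" "\<phi> u \<noteq> -\<infinity>"
  shows "\<phi> u = ereal (real_of_ereal (\<phi> u))"
  using assms by (cases "\<phi> u") (auto simp: limiting_subdiff_def)

lemma prox_regular_onD:
  assumes "prox_regular_on \<phi> U V r" "\<phi> u \<noteq> -\<infinity>"
    and "v \<in> limiting_subdiff \<phi> u" "v \<in> V" "u \<in> U" "x \<in> U"
  shows "ereal (real_of_ereal (\<phi> u) + v \<bullet> (x - u) - r / 2 * (norm (x - u))\<^sup>2) \<le> \<phi> x"
proof -
  have "\<phi> u + ereal (v \<bullet> (x - u)) - ereal (r / 2 * (norm (x - u))\<^sup>2) \<le> \<phi> x"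
    using assms unfolding prox_regular_on_def by blast
  then show ?thesis
    by (subst (asm) limiting_subdiff_finite[OF assms(3,2)]) simp
qed

text \<open>Add the two quadratic minorants, each evaluated at the base point of the other.\<close>

lemma prox_regular_on_hypomonotone:
  fixes \<phi> :: "'a::real_inner \<Rightarrow> ereal"
  assumes nm: "\<And>x. \<phi> x \<noteq> -\<infinity>" and pr: "prox_regular_on \<phi> U V r"
    and u: "u \<in> U" "v \<in> limiting_subdiff \<phi> u" "v \<in> V"
    and y: "y \<in> U" "w \<in> limiting_subdiff \<phi> y" "w \<in> V"
  shows "- r * (norm (u - y))\<^sup>2 \<le> (v - w) \<bullet> (u - y)"
proof -
  have "ereal (real_of_ereal (\<phi> u) + v \<bullet> (y - u) - r / 2 * (norm (y - u))\<^sup>2)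
      \<le> ereal (real_of_ereal (\<phi> y))"
    using prox_regular_onD[OF pr nm u(2,3,1) y(1)] limiting_subdiff_finite[OF y(2) nm] by simp
  moreover have "ereal (real_of_ereal (\<phi> y) + w \<bullet> (u - y) - r / 2 * (norm (u - y))\<^sup>2)
      \<le> ereal (real_of_ereal (\<phi> u))"
    using prox_regular_onD[OF pr nm y(2,3,1) u(1)] limiting_subdiff_finite[OF u(2) nm] by simp
  ultimately show ?thesis
    by (simp add: norm_minus_commute[of y u] inner_diff_left inner_diff_right)
qed

text \<open>
  The limiting subdifferential demands convergence of the values \<open>\<phi>(z\<^sub>n)\<close>, which norm convergence of
  \<open>z\<^sub>n\<close> and \<open>v\<^sub>n\<close> alone does not give. Here it follows from the minorants at \<open>z\<^sub>n\<close>: evaluated at \<open>a\<close>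
  they bound the values from above, so that \<open>\<phi>(z')\<close> is finite; evaluated at \<open>z'\<close> they show that the
  upper limit of the values is at most \<open>\<phi>(z')\<close>. Lower semicontinuity is the other half.
\<close>

lemma prox_regular_on_subgradient_limit:
  fixes \<phi> :: "'a::real_inner \<Rightarrow> ereal"
  assumes nm: "\<And>x. \<phi> x \<noteq> -\<infinity>" and cl: "closed (epi \<phi>)"
    and pr: "prox_regular_on \<phi> U V r" and a: "a \<in> U" "\<phi> a < \<infinity>"
    and sub: "\<And>n. v n \<in> regular_subdiff \<phi> (z n)" "\<And>n. v n \<in> V" "\<And>n. z n \<in> U"
    and lim: "z \<longlonglongrightarrow> z'" "v \<longlonglongrightarrow> v'" and z': "z' \<in> U"
  shows "v' \<in> limiting_subdiff \<phi> z'"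
proof -
  define f where "f n = real_of_ereal (\<phi> (z n))" for n
  have subl: "v n \<in> limiting_subdiff \<phi> (z n)" for n
    using sub(1) regular_subdiff_subset_limiting by blast
  have f: "\<phi> (z n) = ereal (f n)" for n
    unfolding f_def by (rule limiting_subdiff_finite[OF subl nm])
  define b where "b x n = real_of_ereal (\<phi> x) - v n \<bullet> (x - z n) + r / 2 * (norm (x - z n))\<^sup>2"
    for x n
  have up: "f n \<le> b x n" if x: "x \<in> U" "\<phi> x < \<infinity>" for x n
  proof -
    have "\<phi> x = ereal (real_of_ereal (\<phi> x))"
      using x(2) nm[of x] by (cases "\<phi> x") auto
    moreover have "ereal (f n + v n \<bullet> (x - z n) - r / 2 * (norm (x - z n))\<^sup>2) \<le> \<phi> x"
      unfolding f_def by (rule prox_regular_onD[OF pr nm subl sub(2,3) x(1)])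
    ultimately have "ereal (f n + v n \<bullet> (x - z n) - r / 2 * (norm (x - z n))\<^sup>2)
        \<le> ereal (real_of_ereal (\<phi> x))" by simp
    then show ?thesis by (simp add: b_def)
  qed
  have blim: "b x \<longlonglongrightarrow> real_of_ereal (\<phi> x) - v' \<bullet> (x - z') + r / 2 * (norm (x - z'))\<^sup>2" for x
    unfolding b_def[abs_def] by (intro tendsto_intros lim)
  have "(z', real_of_ereal (\<phi> a) - v' \<bullet> (a - z') + r / 2 * (norm (a - z'))\<^sup>2) \<in> epi \<phi>"
  proof (rule closed_sequentially[OF cl])
    show "(z n, b a n) \<in> epi \<phi>" for n
      using up[OF a, of n] f[of n] by (simp add: epi_def)
    show "(\<lambda>n. (z n, b a n)) \<longlonglongrightarrow>
        (z', real_of_ereal (\<phi> a) - v' \<bullet> (a - z') + r / 2 * (norm (a - z'))\<^sup>2)"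
      by (intro tendsto_Pair lim blim)
  qed
  then have fin: "\<phi> z' < \<infinity>"
    using le_less_trans by (fastforce simp: epi_def)
  have "(\<lambda>n. \<phi> (z n)) \<longlonglongrightarrow> \<phi> z'"
  proof (rule order_tendstoI)
    fix c assume "c < \<phi> z'"
    then obtain c' where c': "c < ereal c'" "ereal c' < \<phi> z'" using ereal_dense2 by blast
    have "eventually (\<lambda>n. (z n, c') \<in> - epi \<phi>) sequentially"
    proof (rule topological_tendstoD)
      show "(\<lambda>n. (z n, c')) \<longlonglongrightarrow> (z', c')" by (intro tendsto_intros lim)
    qed (use cl c'(2) in \<open>auto simp: epi_def closed_def\<close>)
    then show "eventually (\<lambda>n. c < \<phi> (z n)) sequentially"
      by eventually_elim (use c'(1) in \<open>auto simp: epi_def not_le intro: less_trans\<close>)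
  next
    fix c assume c: "\<phi> z' < c"
    have "b z' \<longlonglongrightarrow> real_of_ereal (\<phi> z')" using blim[of z'] by simp
    moreover have "\<phi> z' = ereal (real_of_ereal (\<phi> z'))"
      using fin nm[of z'] by (cases "\<phi> z'") auto
    ultimately have "(\<lambda>n. ereal (b z' n)) \<longlonglongrightarrow> \<phi> z'"
      by (metis tendsto_ereal)
    then have "eventually (\<lambda>n. ereal (b z' n) < c) sequentially"
      using c by (rule order_tendstoD(2))
    then show "eventually (\<lambda>n. \<phi> (z n) < c) sequentially"
    proof eventually_elim
      case (elim n)
      have "\<phi> (z n) \<le> ereal (b z' n)" using up[OF z' fin, of n] by (simp add: f)
      then show ?case using elim by (rule le_less_trans)
    qed
  qed
  moreover have "weakly_converges v v'"
    unfolding weakly_converges_def by (intro allI tendsto_intros lim)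
  ultimately show ?thesis
    unfolding limiting_subdiff_def using fin lim(1) sub(1) by blast
qed

section \<open>Localized resolvents of the subdifferential\<close>

text \<open>
  Apply the variational principle to \<open>F = \<phi> + \<mu>/2 \<parallel>\<cdot> - x0\<parallel>\<^sup>2 - \<langle>w, \<cdot> - x0\<rangle>\<close> on the closed ball. The
  minorant of \<open>\<phi>\<close> at \<open>(x0, v0)\<close> yields
  \<open>F(x) \<ge> F(x0) + (\<mu> - r)/2 \<parallel>x - x0\<parallel>\<^sup>2 - \<parallel>w - v0\<parallel> \<parallel>x - x0\<parallel>\<close>, so a point \<open>z\<close> with
  \<open>F(z) \<le> F(x0)\<close> lies in the interior of the ball when \<open>w\<close> is close to \<open>v0\<close>, and the
  inequality at \<open>z\<close> is one for a regular subgradient of \<open>\<phi>\<close>.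
\<close>

lemma approximate_resolvent:
  fixes \<phi> :: "'a::{real_inner, complete_space} \<Rightarrow> ereal"
  assumes nm: "\<And>x. \<phi> x \<noteq> -\<infinity>" and cl: "closed (epi \<phi>)"
    and pr: "prox_regular_on \<phi> (cball x0 \<rho>) (cball v0 \<delta>) r"
    and v0: "v0 \<in> limiting_subdiff \<phi> x0" and pos: "\<rho> > 0" "\<delta> > 0" "r < \<mu>"
    and w: "2 * norm (w - v0) < (\<mu> - r) * \<rho>" and \<epsilon>: "\<epsilon> > 0"
  obtains z e where "norm e \<le> \<epsilon>" "(\<mu> - r) * norm (z - x0) \<le> 2 * norm (w - v0)"
    "w - \<mu> *\<^sub>R (z - x0) + e \<in> regular_subdiff \<phi> z"
proof -
  define S where "S = {x \<in> cball x0 \<rho>. \<phi> x < \<infinity>}"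
  define F where "F x = real_of_ereal (\<phi> x) + (\<mu> / 2 * (norm (x - x0))\<^sup>2 - w \<bullet> (x - x0))" for x
  have fin: "\<phi> x = ereal (real_of_ereal (\<phi> x))" if "x \<in> S" for x
    using that nm[of x] by (cases "\<phi> x") (auto simp: S_def)
  have x0: "x0 \<in> S"
    using v0 pos by (auto simp: S_def limiting_subdiff_def)
  have growth: "F x0 + (\<mu> - r) / 2 * (norm (x - x0))\<^sup>2 - norm (w - v0) * norm (x - x0) \<le> F x"
    if x: "x \<in> S" for x
  proof -
    have "ereal (real_of_ereal (\<phi> x0) + v0 \<bullet> (x - x0) - r / 2 * (norm (x - x0))\<^sup>2)
        \<le> ereal (real_of_ereal (\<phi> x))"
      using prox_regular_onD[OF pr nm v0, of x] x pos fin[OF x] by (simp add: S_def)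
    moreover have "(w - v0) \<bullet> (x - x0) \<le> norm (w - v0) * norm (x - x0)"
      by (rule norm_cauchy_schwarz)
    ultimately show ?thesis by (simp add: F_def inner_diff_left field_simps)
  qed
  have S_epi: "{(x, c). x \<in> S \<and> F x \<le> c} =
     (cball x0 \<rho> \<times> UNIV) \<inter> (\<lambda>(x, c). (x, c - (\<mu> / 2 * (norm (x - x0))\<^sup>2 - w \<bullet> (x - x0)))) -` epi \<phi>"
    (is "_ = ?B \<inter> ?h -` _")
  proof (rule set_eqI, clarify)
    fix x c
    show "(x, c) \<in> {(x, c). x \<in> S \<and> F x \<le> c} \<longleftrightarrow> (x, c) \<in> ?B \<inter> ?h -` epi \<phi>"
    proof (cases "\<phi> x")
      case (real t)
      then show ?thesis by (auto simp: S_def F_def epi_def)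
    qed (use nm[of x] in \<open>auto simp: S_def epi_def\<close>)
  qed
  have clF: "closed {(x, c). x \<in> S \<and> F x \<le> c}"
    unfolding S_epi
    by (intro closed_Int closed_Times closed_vimage cl)
      (auto simp: split_beta intro!: continuous_intros)
  have bdF: "F x0 - norm (w - v0) * \<rho> \<le> F x" if x: "x \<in> S" for x
  proof -
    have "norm (x - x0) \<le> \<rho>" using x by (simp add: S_def dist_norm norm_minus_commute)
    then have "norm (w - v0) * norm (x - x0) \<le> norm (w - v0) * \<rho>"
      by (intro mult_left_mono) auto
    moreover have "0 \<le> (\<mu> - r) / 2 * (norm (x - x0))\<^sup>2" using pos by simp
    ultimately show ?thesis using growth[OF x] by linarith
  qed
  obtain z e where z: "z \<in> S" "F z \<le> F x0" and e: "norm e \<le> \<epsilon>"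
    and min: "\<And>x. x \<in> S \<Longrightarrow> F z + e \<bullet> (x - z) - \<epsilon> * (norm (x - z))\<^sup>2 \<le> F x"
    using quadratic_variational_principle[OF clF bdF x0 \<epsilon>] by blast
  have zle: "(\<mu> - r) * norm (z - x0) \<le> 2 * norm (w - v0)"
  proof (cases "z = x0")
    case False
    have "(\<mu> - r) / 2 * (norm (z - x0))\<^sup>2 \<le> norm (w - v0) * norm (z - x0)"
      using growth[OF z(1)] z(2) by linarith
    then have "norm (z - x0) * ((\<mu> - r) * norm (z - x0)) \<le> norm (z - x0) * (2 * norm (w - v0))"
      by (simp add: power2_eq_square algebra_simps)
    then show ?thesis using False by (simp add: mult_le_cancel_left)
  qed simp
  have "(\<mu> - r) * norm (z - x0) < (\<mu> - r) * \<rho>" using zle w by linarith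
  then have zin: "norm (z - x0) < \<rho>" using pos by simp
  have "w - \<mu> *\<^sub>R (z - x0) + e \<in> regular_subdiff \<phi> z"
  proof (rule proximal_subgradient_regular[where d = "\<rho> - norm (z - x0)" and C = "\<epsilon> + \<mu> / 2"])
    show "\<phi> z = ereal (real_of_ereal (\<phi> z))" by (rule fin[OF z(1)])
    show "0 < \<rho> - norm (z - x0)" using zin by simp
    fix y assume y: "norm (y - z) < \<rho> - norm (z - x0)"
    show "ereal (real_of_ereal (\<phi> z) + (w - \<mu> *\<^sub>R (z - x0) + e) \<bullet> (y - z)
        - (\<epsilon> + \<mu> / 2) * (norm (y - z))\<^sup>2) \<le> \<phi> y"
    proof (cases "\<phi> y < \<infinity>")
      case True
      have "norm (y - x0) \<le> \<rho>"
        using norm_triangle_ineq[of "y - z" "z - x0"] y by simp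
      then have yS: "y \<in> S"
        using True by (simp add: S_def dist_norm norm_minus_commute)
      have "w \<bullet> (y - x0) = w \<bullet> (z - x0) + w \<bullet> (y - z)"
        by (simp add: inner_diff_right)
      moreover have "(w - \<mu> *\<^sub>R (z - x0) + e) \<bullet> (y - z)
          = w \<bullet> (y - z) - \<mu> * ((z - x0) \<bullet> (y - z)) + e \<bullet> (y - z)"
        by (simp add: inner_add_left inner_diff_left)
      ultimately have "real_of_ereal (\<phi> z) + (w - \<mu> *\<^sub>R (z - x0) + e) \<bullet> (y - z)
        - (\<epsilon> + \<mu> / 2) * (norm (y - z))\<^sup>2 \<le> real_of_ereal (\<phi> y)"
        using min[OF yS] norm_sq_expand[of y x0 z] by (simp add: F_def algebra_simps)
      then show ?thesis using fin[OF yS] by (metis ereal_less_eq(3))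
    qed simp
  qed
  then show thesis using that e zle by blast
qed

text \<open>
  Approximate resolvents \<open>z\<^sub>n\<close> with errors \<open>e\<^sub>n \<longlonglongrightarrow> 0\<close> satisfy
  \<open>(\<mu> - r) \<parallel>z\<^sub>m - z\<^sub>n\<parallel> \<le> \<parallel>e\<^sub>m - e\<^sub>n\<parallel>\<close> by hypomonotonicity, as long as their subgradients stay within
  \<open>\<delta>\<close> of \<open>v0\<close>. The bounds on \<open>\<eta>\<close> ensure this: the approximate solutions lie within \<open>2\<eta>\<close> of \<open>x0\<close>, hence
  their subgradients within \<open>(\<mu> - r)\<eta> + 2\<mu>\<eta> = (3\<mu> - r)\<eta>\<close> of \<open>v0\<close>, up to the error. For the limit,
  comparison with \<open>(x0, v0)\<close> itself removes the factor 2, which is what makes the resolvent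
  map a ball around \<open>v0\<close> into the ball of radius \<open>\<eta>\<close>.
\<close>

lemma localized_resolvent:
  fixes \<phi> :: "'a::{real_inner, complete_space} \<Rightarrow> ereal"
  assumes nm: "\<And>x. \<phi> x \<noteq> -\<infinity>" and cl: "closed (epi \<phi>)"
    and pr: "prox_regular_on \<phi> (cball x0 \<rho>) (cball v0 \<delta>) r"
    and v0: "v0 \<in> limiting_subdiff \<phi> x0" and pos: "\<rho> > 0" "\<delta> > 0" "0 < r" "r < \<mu>"
    and w: "norm (w - v0) \<le> (\<mu> - r) * \<eta>" and \<eta>: "2 * \<eta> < \<rho>" "(3 * \<mu> - r) * \<eta> < \<delta>"
  obtains z where "z \<in> cball x0 \<eta>" "w - \<mu> *\<^sub>R (z - x0) \<in> limiting_subdiff \<phi> z"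
    "w - \<mu> *\<^sub>R (z - x0) \<in> cball v0 \<delta>"
proof -
  define \<epsilon> where "\<epsilon> n = (\<delta> - (3 * \<mu> - r) * \<eta>) * inverse (real (Suc n))" for n
  have gap: "0 < \<delta> - (3 * \<mu> - r) * \<eta>" using \<eta>(2) by simp
  have \<epsilon>pos: "\<epsilon> n > 0" for n unfolding \<epsilon>_def using gap by simp
  have \<epsilon>le: "\<epsilon> n \<le> \<delta> - (3 * \<mu> - r) * \<eta>" for n
  proof -
    have "\<epsilon> n \<le> (\<delta> - (3 * \<mu> - r) * \<eta>) * 1"
      unfolding \<epsilon>_def using gap by (intro mult_left_mono) (auto simp: field_simps)
    then show ?thesis by simp
  qed
  have \<epsilon>0: "\<epsilon> \<longlonglongrightarrow> 0"
    unfolding \<epsilon>_def[abs_def]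
    using tendsto_mult_right_zero[OF LIMSEQ_inverse_real_of_nat] by blast
  have "(\<mu> - r) * (2 * \<eta>) < (\<mu> - r) * \<rho>" using \<eta>(1) pos by simp
  then have w2: "2 * norm (w - v0) < (\<mu> - r) * \<rho>" using w by linarith
  have "\<forall>n. \<exists>z e. norm e \<le> \<epsilon> n \<and> (\<mu> - r) * norm (z - x0) \<le> 2 * norm (w - v0) \<and>
    w - \<mu> *\<^sub>R (z - x0) + e \<in> regular_subdiff \<phi> z"
    using approximate_resolvent[OF nm cl pr v0 pos(1,2,4) w2 \<epsilon>pos] by metis
  then obtain z e where e: "\<And>n. norm (e n) \<le> \<epsilon> n"
    and z: "\<And>n. (\<mu> - r) * norm (z n - x0) \<le> 2 * norm (w - v0)"
    and sub: "\<And>n. w - \<mu> *\<^sub>R (z n - x0) + e n \<in> regular_subdiff \<phi> (z n)"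
    by metis
  define v where "v n = w - \<mu> *\<^sub>R (z n - x0) + e n" for n
  have z2: "norm (z n - x0) \<le> 2 * \<eta>" for n
  proof -
    have "(\<mu> - r) * norm (z n - x0) \<le> (\<mu> - r) * (2 * \<eta>)" using z[of n] w by linarith
    then show ?thesis using pos by simp
  qed
  have zU: "z n \<in> cball x0 \<rho>" for n
    using z2[of n] \<eta> by (simp add: dist_norm norm_minus_commute)
  have vV: "v n \<in> cball v0 \<delta>" for n
  proof -
    have "v n - v0 = (w - v0) + (- \<mu> *\<^sub>R (z n - x0)) + e n" by (simp add: v_def)
    then have "norm (v n - v0) \<le> norm (w - v0) + norm (- \<mu> *\<^sub>R (z n - x0)) + norm (e n)"
      by (metis norm_triangle_le norm_triangle_ineq add_mono order_refl)
    also have "norm (- \<mu> *\<^sub>R (z n - x0)) = \<mu> * norm (z n - x0)" using pos by simp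
    also have "\<mu> * norm (z n - x0) \<le> \<mu> * (2 * \<eta>)"
      using z2[of n] pos by (intro mult_left_mono) auto
    finally have "norm (v n - v0) \<le> (\<mu> - r) * \<eta> + \<mu> * (2 * \<eta>) + \<epsilon> n"
      using w e[of n] by linarith
    also have "\<dots> \<le> \<delta>" using \<epsilon>le[of n] by (simp add: algebra_simps)
    finally show ?thesis by (simp add: dist_norm norm_minus_commute)
  qed
  have vsub: "v n \<in> limiting_subdiff \<phi> (z n)" for n
    using sub regular_subdiff_subset_limiting unfolding v_def by blast
  have diff: "(\<mu> - r) * norm (z m - z n) \<le> \<epsilon> m + \<epsilon> n" for m n
  proof -
    have "- r * (norm (z m - z n))\<^sup>2 \<le> (v m - v n) \<bullet> (z m - z n)"
      by (rule prox_regular_on_hypomonotone[OF nm pr zU vsub vV zU vsub vV])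
    also have "v m - v n = (e m - e n) - \<mu> *\<^sub>R (z m - z n)"
      by (simp add: v_def algebra_simps)
    also have "((e m - e n) - \<mu> *\<^sub>R (z m - z n)) \<bullet> (z m - z n)
        = (e m - e n) \<bullet> (z m - z n) - \<mu> * (norm (z m - z n))\<^sup>2"
      by (simp add: inner_diff_left[of "e m - e n"] power2_norm_eq_inner)
    finally have "(\<mu> - r) * (norm (z m - z n))\<^sup>2 \<le> (e m - e n) \<bullet> (z m - z n)"
      by (simp add: algebra_simps)
    also have "\<dots> \<le> norm (e m - e n) * norm (z m - z n)" by (rule norm_cauchy_schwarz)
    finally have "norm (z m - z n) * ((\<mu> - r) * norm (z m - z n))
        \<le> norm (z m - z n) * norm (e m - e n)"
      by (simp add: power2_eq_square algebra_simps)
    then have "(\<mu> - r) * norm (z m - z n) \<le> norm (e m - e n)"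
      by (cases "z m = z n") (auto simp: mult_le_cancel_left)
    also have "\<dots> \<le> \<epsilon> m + \<epsilon> n"
      using norm_triangle_ineq4[of "e m" "e n"] e[of m] e[of n] by linarith
    finally show ?thesis .
  qed
  have "Cauchy z"
  proof (rule metric_CauchyI)
    fix d :: real assume "d > 0"
    then have "0 < (\<mu> - r) * d / 2" using pos by simp
    then obtain M where M: "\<And>n. n \<ge> M \<Longrightarrow> \<epsilon> n < (\<mu> - r) * d / 2"
      using order_tendstoD(2)[OF \<epsilon>0, of "(\<mu> - r) * d / 2"] by (auto simp: eventually_sequentially)
    have "dist (z m) (z n) < d" if "m \<ge> M" "n \<ge> M" for m n
    proof -
      have "(\<mu> - r) * norm (z m - z n) < (\<mu> - r) * d"
        using diff[of m n] M[OF that(1)] M[OF that(2)] by linarith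
      then show ?thesis using pos by (simp add: dist_norm)
    qed
    then show "\<exists>M. \<forall>m\<ge>M. \<forall>n\<ge>M. dist (z m) (z n) < d" by blast
  qed
  then obtain z' where z': "z \<longlonglongrightarrow> z'"
    using Cauchy_convergent convergent_def by blast
  have e0: "e \<longlonglongrightarrow> 0"
    by (rule Lim_null_comparison[OF _ \<epsilon>0]) (simp add: e)
  have "(\<lambda>n. w - \<mu> *\<^sub>R (z n - x0) + e n) \<longlonglongrightarrow> w - \<mu> *\<^sub>R (z' - x0) + 0"
    by (intro tendsto_intros z' e0)
  then have vlim: "v \<longlonglongrightarrow> w - \<mu> *\<^sub>R (z' - x0)" by (simp add: v_def[abs_def])
  have zc: "z' \<in> cball x0 \<rho>" by (rule closed_sequentially[OF closed_cball zU z'])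
  have vc: "w - \<mu> *\<^sub>R (z' - x0) \<in> cball v0 \<delta>" by (rule closed_sequentially[OF closed_cball vV vlim])
  have fin: "\<phi> x0 < \<infinity>" "x0 \<in> cball x0 \<rho>" using v0 pos by (auto simp: limiting_subdiff_def)
  have sub': "w - \<mu> *\<^sub>R (z' - x0) \<in> limiting_subdiff \<phi> z'"
    by (rule prox_regular_on_subgradient_limit[OF nm cl pr fin(2,1) _ vV zU z' vlim zc])
      (use sub in \<open>simp add: v_def\<close>)
  have "- r * (norm (z' - x0))\<^sup>2 \<le> (w - \<mu> *\<^sub>R (z' - x0) - v0) \<bullet> (z' - x0)"
    by (rule prox_regular_on_hypomonotone[OF nm pr zc sub' vc fin(2) v0]) (use pos in simp)
  also have "\<dots> = (w - v0) \<bullet> (z' - x0) - \<mu> * (norm (z' - x0))\<^sup>2"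
    by (simp add: inner_diff_left inner_diff_right power2_norm_eq_inner algebra_simps)
  finally have "(\<mu> - r) * (norm (z' - x0))\<^sup>2 \<le> norm (w - v0) * norm (z' - x0)"
    using norm_cauchy_schwarz[of "w - v0" "z' - x0"] by (simp add: algebra_simps)
  also have "\<dots> \<le> ((\<mu> - r) * \<eta>) * norm (z' - x0)"
    using w by (intro mult_right_mono) auto
  finally have "((\<mu> - r) * norm (z' - x0)) * norm (z' - x0) \<le> ((\<mu> - r) * norm (z' - x0)) * \<eta>"
    by (simp add: power2_eq_square algebra_simps)
  moreover have "0 \<le> (\<mu> - r) * \<eta>" using w norm_ge_zero[of "w - v0"] by linarith
  then have "0 \<le> \<eta>" using pos by (simp add: zero_le_mult_iff)
  ultimately have "norm (z' - x0) \<le> \<eta>"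
    using pos by (cases "z' = x0") (auto simp: mult_le_cancel_left)
  then have "z' \<in> cball x0 \<eta>" by (simp add: dist_norm norm_minus_commute)
  then show thesis using that sub' vc by blast
qed


section \<open>Solving the generalized equation for a fixed parameter\<close>

text \<open>With \<open>s = (r + \<sigma>)/2\<close> strictly between \<open>r\<close> and \<open>\<sigma>\<close>, the choice \<open>c = \<mu> - s\<close> turns the last
  condition into \<open>L\<^sup>2 \<le> 2\<mu>(\<sigma> - s) + s\<^sup>2\<close>, which holds for large \<open>\<mu>\<close>.\<close>

lemma forward_step_constants:
  fixes r \<sigma> L :: real
  assumes "0 < r" "r < \<sigma>"
  obtains \<mu> c where "r < \<mu>" "0 \<le> c" "c < \<mu> - r" "\<mu>\<^sup>2 - 2 * \<mu> * \<sigma> + L\<^sup>2 \<le> c\<^sup>2"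
proof -
  define s where "s = (r + \<sigma>) / 2"
  define \<mu> where "\<mu> = s + L\<^sup>2 / (2 * (\<sigma> - s))"
  have s: "r < s" "s < \<sigma>" using assms by (simp_all add: s_def)
  have ge: "s \<le> \<mu>" unfolding \<mu>_def using s by simp
  have "L\<^sup>2 = (\<mu> - s) * (2 * (\<sigma> - s))" using s by (simp add: \<mu>_def)
  also have "\<dots> \<le> \<mu> * (2 * (\<sigma> - s)) + s\<^sup>2"
  proof -
    have "0 \<le> s * (2 * (\<sigma> - s))" using s assms by simp
    then show ?thesis by (simp add: left_diff_distrib add_increasing2)
  qed
  finally have "\<mu>\<^sup>2 - 2 * \<mu> * \<sigma> + L\<^sup>2 \<le> (\<mu> - s)\<^sup>2"
    by (simp add: power2_eq_square algebra_simps)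
  then show thesis using that[of \<mu> "\<mu> - s"] ge s by simp
qed

lemma forward_step_lipschitz:
  fixes h :: "'a::real_inner \<Rightarrow> 'a"
  assumes lip: "norm (h x - h y) \<le> L * norm (x - y)"
    and mon: "(h x - h y) \<bullet> (x - y) \<ge> \<sigma> * (norm (x - y))\<^sup>2"
    and c: "0 \<le> \<mu>" "0 \<le> c" "\<mu>\<^sup>2 - 2 * \<mu> * \<sigma> + L\<^sup>2 \<le> c\<^sup>2"
  shows "norm ((\<mu> *\<^sub>R x - h x) - (\<mu> *\<^sub>R y - h y)) \<le> c * norm (x - y)"
proof (rule power2_le_imp_le)
  define u where "u = x - y"
  define k where "k = h x - h y"
  have "(\<mu> *\<^sub>R x - h x) - (\<mu> *\<^sub>R y - h y) = \<mu> *\<^sub>R u - k"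
    by (simp add: u_def k_def algebra_simps)
  then have "(norm ((\<mu> *\<^sub>R x - h x) - (\<mu> *\<^sub>R y - h y)))\<^sup>2
      = \<mu>\<^sup>2 * (norm u)\<^sup>2 - 2 * \<mu> * (k \<bullet> u) + (norm k)\<^sup>2"
    by (simp only: power2_norm_eq_inner inner_diff_left inner_diff_right inner_scaleR_left
        inner_scaleR_right) (simp add: inner_commute power2_eq_square algebra_simps)
  also have "\<dots> \<le> \<mu>\<^sup>2 * (norm u)\<^sup>2 - 2 * \<mu> * (\<sigma> * (norm u)\<^sup>2) + (L * norm u)\<^sup>2"
  proof -
    have "2 * \<mu> * (\<sigma> * (norm u)\<^sup>2) \<le> 2 * \<mu> * (k \<bullet> u)"
      using mon c by (intro mult_left_mono) (auto simp: u_def k_def)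
    moreover have "(norm k)\<^sup>2 \<le> (L * norm u)\<^sup>2"
      using lip by (intro power_mono) (auto simp: u_def k_def)
    ultimately show ?thesis by linarith
  qed
  also have "\<dots> = (\<mu>\<^sup>2 - 2 * \<mu> * \<sigma> + L\<^sup>2) * (norm u)\<^sup>2"
    by (simp add: power_mult_distrib algebra_simps)
  also have "\<dots> \<le> c\<^sup>2 * (norm u)\<^sup>2"
    using c by (intro mult_right_mono) auto
  finally show "(norm ((\<mu> *\<^sub>R x - h x) - (\<mu> *\<^sub>R y - h y)))\<^sup>2 \<le> (c * norm (x - y))\<^sup>2"
    by (simp add: power_mult_distrib u_def)
qed (use c in simp)

text \<open>
  The solutions are the fixed points of \<open>x \<mapsto> J(v - h(x) + \<mu>(x - x0))\<close>, where \<open>J\<close> is the localized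
  resolvent. Hypomonotonicity gives \<open>J\<close> the Lipschitz constant \<open>1/(\<mu> - r)\<close>, so the map is a contraction
  with constant \<open>c/(\<mu> - r)\<close>. The argument of \<open>J\<close> stays within \<open>(\<mu> - r)\<eta>\<close> of \<open>v0\<close> on the ball of
  radius \<open>\<eta>\<close> exactly because \<open>v\<close> is within \<open>(\<mu> - r - c)\<eta>\<close> of \<open>v0 + h(x0)\<close>. All bounds depend on \<open>\<phi>\<close>
  and \<open>h\<close> only through the constants \<open>\<rho>, \<delta>, r, L, \<sigma>\<close>, and this makes the existence uniform in the
  parameters.
\<close>

lemma generalized_equation_solvable:
  fixes \<phi> :: "'a::{real_inner, complete_space} \<Rightarrow> ereal" and h :: "'a \<Rightarrow> 'a"
  assumes nm: "\<And>x. \<phi> x \<noteq> -\<infinity>" and cl: "closed (epi \<phi>)"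
    and pr: "prox_regular_on \<phi> (cball x0 \<rho>) (cball v0 \<delta>) r"
    and v0: "v0 \<in> limiting_subdiff \<phi> x0" and pos: "\<rho> > 0" "\<delta> > 0" "0 < r" "r < \<mu>"
    and \<eta>: "0 \<le> \<eta>" "2 * \<eta> < \<rho>" "(3 * \<mu> - r) * \<eta> < \<delta>"
    and lip: "\<And>x y. x \<in> cball x0 \<rho> \<Longrightarrow> y \<in> cball x0 \<rho> \<Longrightarrow> norm (h x - h y) \<le> L * norm (x - y)"
    and mon: "\<And>x y. x \<in> cball x0 \<rho> \<Longrightarrow> y \<in> cball x0 \<rho> \<Longrightarrow>
        (h x - h y) \<bullet> (x - y) \<ge> \<sigma> * (norm (x - y))\<^sup>2"
    and c: "0 \<le> c" "c < \<mu> - r" "\<mu>\<^sup>2 - 2 * \<mu> * \<sigma> + L\<^sup>2 \<le> c\<^sup>2"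
    and v: "norm (v - (v0 + h x0)) \<le> (\<mu> - r - c) * \<eta>"
  obtains x where "x \<in> cball x0 \<eta>" "v - h x \<in> limiting_subdiff \<phi> x"
proof -
  define w where "w x = v - h x + \<mu> *\<^sub>R (x - x0)" for x
  have sub: "x \<in> cball x0 \<rho>" if "x \<in> cball x0 \<eta>" for x
    using that \<eta> by simp
  have wlip: "norm (w x - w y) \<le> c * norm (x - y)"
    if "x \<in> cball x0 \<eta>" "y \<in> cball x0 \<eta>" for x y
  proof -
    have "w x - w y = (\<mu> *\<^sub>R x - h x) - (\<mu> *\<^sub>R y - h y)"
      by (simp add: w_def algebra_simps)
    then show ?thesis
      using forward_step_lipschitz[OF lip[OF that[THEN sub]] mon[OF that[THEN sub]] _ c(1,3)] pos
      by simp
  qed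
  have wv0: "norm (w x - v0) \<le> (\<mu> - r) * \<eta>" if x: "x \<in> cball x0 \<eta>" for x
  proof -
    have x0: "x0 \<in> cball x0 \<eta>" using \<eta> by simp
    have "w x - v0 = (v - (v0 + h x0)) + (w x - w x0)"
      by (simp add: w_def algebra_simps)
    then have "norm (w x - v0) \<le> norm (v - (v0 + h x0)) + norm (w x - w x0)"
      by (metis norm_triangle_ineq)
    also have "\<dots> \<le> (\<mu> - r - c) * \<eta> + c * norm (x - x0)"
      using v wlip[OF x x0] by linarith
    also have "c * norm (x - x0) \<le> c * \<eta>"
      using x c by (intro mult_left_mono) (auto simp: dist_norm norm_minus_commute)
    finally show ?thesis by (simp add: algebra_simps)
  qed
  have "\<forall>x\<in>cball x0 \<eta>. \<exists>z. z \<in> cball x0 \<eta> \<and> w x - \<mu> *\<^sub>R (z - x0) \<in> limiting_subdiff \<phi> z \<inter> cball v0 \<delta>"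
    using localized_resolvent[OF nm cl pr v0 pos wv0 \<eta>(2,3)] by blast
  then obtain J where J: "\<And>x. x \<in> cball x0 \<eta> \<Longrightarrow> J x \<in> cball x0 \<eta>"
      "\<And>x. x \<in> cball x0 \<eta> \<Longrightarrow> w x - \<mu> *\<^sub>R (J x - x0) \<in> limiting_subdiff \<phi> (J x)"
      "\<And>x. x \<in> cball x0 \<eta> \<Longrightarrow> w x - \<mu> *\<^sub>R (J x - x0) \<in> cball v0 \<delta>"
    by (metis IntE)
  have contr: "dist (J x) (J y) \<le> c / (\<mu> - r) * dist x y"
    if x: "x \<in> cball x0 \<eta>" and y: "y \<in> cball x0 \<eta>" for x y
  proof (cases "J x = J y")
    case False
    have "- r * (norm (J x - J y))\<^sup>2
        \<le> ((w x - \<mu> *\<^sub>R (J x - x0)) - (w y - \<mu> *\<^sub>R (J y - x0))) \<bullet> (J x - J y)"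
      by (rule prox_regular_on_hypomonotone[OF nm pr sub[OF J(1)[OF x]] J(2,3)[OF x]
            sub[OF J(1)[OF y]] J(2,3)[OF y]])
    also have "(w x - \<mu> *\<^sub>R (J x - x0)) - (w y - \<mu> *\<^sub>R (J y - x0)) = (w x - w y) - \<mu> *\<^sub>R (J x - J y)"
      by (simp add: algebra_simps)
    also have "((w x - w y) - \<mu> *\<^sub>R (J x - J y)) \<bullet> (J x - J y)
        = (w x - w y) \<bullet> (J x - J y) - \<mu> * (norm (J x - J y))\<^sup>2"
      by (simp add: inner_diff_left[of "w x - w y"] power2_norm_eq_inner)
    also have "(w x - w y) \<bullet> (J x - J y) \<le> norm (w x - w y) * norm (J x - J y)"
      by (rule norm_cauchy_schwarz)
    also have "norm (w x - w y) * norm (J x - J y) \<le> c * norm (x - y) * norm (J x - J y)"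
      using wlip[OF x y] by (intro mult_right_mono) auto
    finally have "norm (J x - J y) * ((\<mu> - r) * norm (J x - J y))
        \<le> norm (J x - J y) * (c * norm (x - y))"
      by (simp add: power2_eq_square algebra_simps)
    then have "(\<mu> - r) * norm (J x - J y) \<le> c * norm (x - y)"
      using False by (simp add: mult_le_cancel_left)
    then show ?thesis
      using pos by (simp add: dist_norm field_simps)
  qed (use c pos in simp)
  have "\<exists>!x\<in>cball x0 \<eta>. J x = x"
  proof (rule Banach_fix)
    show "complete (cball x0 \<eta>)" by (simp add: complete_eq_closed)
    show "c / (\<mu> - r) < 1" "0 \<le> c / (\<mu> - r)" using c pos by simp_all
  qed (use J(1) \<eta>(1) contr in auto)
  then obtain x where x: "x \<in> cball x0 \<eta>" "J x = x" by blast
  then have "v - h x \<in> limiting_subdiff \<phi> x"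
    using J(2)[OF x(1)] by (simp add: w_def)
  then show thesis using that x(1) by blast
qed


section \<open>Uniform neighborhoods and comparison of solutions\<close>

lemma prox_threshold_less_witness:
  assumes "param_cont_prox_regular g x0 p0 v0" "prox_threshold g x0 p0 v0 < \<sigma>"
  obtains r where "0 < r" "r < \<sigma>" "prox_regular_with g x0 p0 v0 r"
proof -
  have "{r. r > 0 \<and> prox_regular_with g x0 p0 v0 r} \<noteq> {}"
    using assms(1) by (auto simp: param_cont_prox_regular_def)
  from cInf_lessD[OF this assms(2)[unfolded prox_threshold_def]] show thesis
    using that by auto
qed

text \<open>Each local hypothesis is made to hold on balls of every sufficiently small common radius
  \<open>\<alpha>\<close>, so that one radius serves for all of them.\<close>

lemma eventually_ball_radius:
  fixes a :: "'a::metric_space"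
  assumes "open A" "a \<in> A"
  shows "eventually (\<lambda>\<alpha>. ball a \<alpha> \<subseteq> A) (at_right 0)"
proof -
  obtain d where d: "d > 0" "ball a d \<subseteq> A" using assms open_contains_ball by blast
  have "eventually (\<lambda>\<alpha>::real. \<alpha> < d) (at_right 0)"
    using d(1) by (intro order_tendstoD(2)[OF tendsto_ident_at])
  then show ?thesis
  proof eventually_elim
    case (elim \<alpha>)
    then show ?case using d(2) subset_ball[of \<alpha> d a] by simp
  qed
qed

text \<open>Parametric prox-regularity restricts the inequality to points \<open>u\<close> with
  \<open>g(u, p) \<le> g(x0, p0) + \<epsilon>\<close>; continuity of \<open>g\<close> relative to the graph of the subdifferential shows that
  all graph points near \<open>(x0, p0, v0)\<close> are of this kind.\<close>

lemma prox_regular_on_uniformly: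
  fixes g :: "'x::real_inner \<Rightarrow> 'p::metric_space \<Rightarrow> ereal"
  assumes pr: "prox_regular_with g x0 p0 v0 r" and nm: "g x0 p0 \<noteq> -\<infinity>"
    and cont: "continuous (at (x0, p0, v0) within gph_subdiff_x g) (\<lambda>(x, p, v). g x p)"
    and v0: "v0 \<in> subdiff_x g x0 p0"
  shows "eventually (\<lambda>\<alpha>. \<forall>p\<in>ball p0 \<alpha>. prox_regular_on (\<lambda>x. g x p) (ball x0 \<alpha>) (ball v0 \<alpha>) r)
    (at_right 0)"
proof -
  obtain U V P \<epsilon> where UVP: "open U" "x0 \<in> U" "open V" "v0 \<in> V" "open P" "p0 \<in> P" and \<epsilon>: "\<epsilon> > 0"
    and ineq: "\<forall>u\<in>U. \<forall>p\<in>P. \<forall>v \<in> subdiff_x g u p \<inter> V. g u p \<le> g x0 p0 + ereal \<epsilon> \<longrightarrow>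
        (\<forall>x\<in>U. g x p \<ge> g u p + ereal (v \<bullet> (x - u)) - ereal (r / 2 * (norm (x - u))\<^sup>2))"
    using pr unfolding prox_regular_with_def by blast
  have lt: "g x0 p0 < g x0 p0 + ereal \<epsilon>"
    using v0 nm \<epsilon> by (cases "g x0 p0") (auto simp: subdiff_x_def limiting_subdiff_def)
  have "((\<lambda>(x, p, v). g x p) \<longlongrightarrow> g x0 p0) (at (x0, p0, v0) within gph_subdiff_x g)"
    using cont by (simp add: continuous_within)
  then have "eventually (\<lambda>s. (case s of (x, p, v) \<Rightarrow> g x p) < g x0 p0 + ereal \<epsilon>)
      (at (x0, p0, v0) within gph_subdiff_x g)"
    using lt by (rule order_tendstoD(2))
  then obtain T where T: "open T" "(x0, p0, v0) \<in> T"
    and Tlt: "\<And>s. s \<in> T \<Longrightarrow> s \<noteq> (x0, p0, v0) \<Longrightarrow> s \<in> gph_subdiff_x g \<Longrightarrow>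
        (case s of (x, p, v) \<Rightarrow> g x p) < g x0 p0 + ereal \<epsilon>"
    unfolding eventually_at_topological by blast
  obtain A B where AB: "open A" "open B" "x0 \<in> A" "(p0, v0) \<in> B" "A \<times> B \<subseteq> T"
    using open_prod_elim[OF T] by (metis mem_Sigma_iff)
  obtain B1 B2 where B: "open B1" "open B2" "p0 \<in> B1" "v0 \<in> B2" "B1 \<times> B2 \<subseteq> B"
    using open_prod_elim[OF AB(2,4)] by (metis mem_Sigma_iff)
  have low: "g u p \<le> g x0 p0 + ereal \<epsilon>"
    if "u \<in> A" "p \<in> B1" "v \<in> B2" "v \<in> subdiff_x g u p" for u p v
  proof (cases "(u, p, v) = (x0, p0, v0)")
    case False
    have "(u, p, v) \<in> T" using that AB(5) B(5) by blast
    then show ?thesis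
      using Tlt[OF _ False] that(4) by (auto simp: gph_subdiff_x_def intro: less_imp_le)
  qed (use lt in auto)
  have "eventually (\<lambda>\<alpha>. ball x0 \<alpha> \<subseteq> U) (at_right 0)" "eventually (\<lambda>\<alpha>. ball x0 \<alpha> \<subseteq> A) (at_right 0)"
    "eventually (\<lambda>\<alpha>. ball v0 \<alpha> \<subseteq> V) (at_right 0)" "eventually (\<lambda>\<alpha>. ball v0 \<alpha> \<subseteq> B2) (at_right 0)"
    "eventually (\<lambda>\<alpha>. ball p0 \<alpha> \<subseteq> P) (at_right 0)" "eventually (\<lambda>\<alpha>. ball p0 \<alpha> \<subseteq> B1) (at_right 0)"
    by (intro eventually_ball_radius UVP AB B)+
  then show ?thesis
  proof eventually_elim
    case (elim \<alpha>)
    show ?case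
      unfolding prox_regular_on_def subdiff_x_def[symmetric]
    proof (intro ballI)
      fix p u v x
      assume "p \<in> ball p0 \<alpha>" "u \<in> ball x0 \<alpha>" "v \<in> subdiff_x g u p \<inter> ball v0 \<alpha>" "x \<in> ball x0 \<alpha>"
      then have h: "u \<in> U" "u \<in> A" "p \<in> P" "p \<in> B1" "v \<in> V" "v \<in> B2" "x \<in> U" "v \<in> subdiff_x g u p"
        using elim by blast+
      show "g x p \<ge> g u p + ereal (v \<bullet> (x - u)) - ereal (r / 2 * (norm (x - u))\<^sup>2)"
        using ineq h low[OF h(2,4,6,8)] by blast
    qed
  qed
qed

lemma lipschitz_like_subdiff_gph:
  fixes g :: "'x::real_inner \<Rightarrow> 'p::metric_space \<Rightarrow> ereal"
  assumes "lipschitz_like (\<lambda>p. gph (\<lambda>x. subdiff_x g x p)) p0 (x0, v0)"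
  obtains l where "l > 0" "eventually (\<lambda>\<alpha>. \<forall>p\<in>ball p0 \<alpha>. \<forall>p'\<in>ball p0 \<alpha>. \<forall>x\<in>ball x0 \<alpha>.
      \<forall>v\<in>ball v0 \<alpha> \<inter> subdiff_x g x p. \<exists>x' v'. v' \<in> subdiff_x g x' p' \<and>
        norm (x - x') \<le> l * dist p p' \<and> norm (v - v') \<le> l * dist p p') (at_right 0)"
proof -
  obtain l U V where l: "l > 0" and UV: "open U" "p0 \<in> U" "open V" "(x0, v0) \<in> V"
    and K: "\<forall>p\<in>U. \<forall>p'\<in>U. gph (\<lambda>x. subdiff_x g x p) \<inter> V
      \<subseteq> {y + (l * dist p p') *\<^sub>R b | y b. y \<in> gph (\<lambda>x. subdiff_x g x p') \<and> b \<in> cball 0 1}"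
    using assms unfolding lipschitz_like_def by blast
  obtain A B where AB: "open A" "open B" "x0 \<in> A" "v0 \<in> B" "A \<times> B \<subseteq> V"
    using open_prod_elim[OF UV(3,4)] by (metis mem_Sigma_iff)
  have "eventually (\<lambda>\<alpha>. ball p0 \<alpha> \<subseteq> U) (at_right 0)" "eventually (\<lambda>\<alpha>. ball x0 \<alpha> \<subseteq> A) (at_right 0)"
    "eventually (\<lambda>\<alpha>. ball v0 \<alpha> \<subseteq> B) (at_right 0)"
    by (intro eventually_ball_radius UV AB)+
  then have "eventually (\<lambda>\<alpha>. \<forall>p\<in>ball p0 \<alpha>. \<forall>p'\<in>ball p0 \<alpha>. \<forall>x\<in>ball x0 \<alpha>.
      \<forall>v\<in>ball v0 \<alpha> \<inter> subdiff_x g x p. \<exists>x' v'. v' \<in> subdiff_x g x' p' \<and>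
        norm (x - x') \<le> l * dist p p' \<and> norm (v - v') \<le> l * dist p p') (at_right 0)"
  proof eventually_elim
    case (elim \<alpha>)
    show ?case
    proof (intro ballI)
      fix p p' x v
      assume h: "p \<in> ball p0 \<alpha>" "p' \<in> ball p0 \<alpha>" "x \<in> ball x0 \<alpha>" "v \<in> ball v0 \<alpha> \<inter> subdiff_x g x p"
      have pU: "p \<in> U" "p' \<in> U" using h elim by blast+
      have "(x, v) \<in> gph (\<lambda>x. subdiff_x g x p) \<inter> V"
        using h elim AB(5) unfolding gph_def by blast
      then obtain y b where y: "(x, v) = y + (l * dist p p') *\<^sub>R b"
          "y \<in> gph (\<lambda>x. subdiff_x g x p')" "b \<in> cball 0 1"
        using K pU by blast
      have "norm (fst b) \<le> 1" "norm (snd b) \<le> 1"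
        using norm_fst_le[of "fst b" "snd b"] norm_snd_le[of "snd b" "fst b"] y(3) by auto
      then have "l * dist p p' * norm (fst b) \<le> l * dist p p' * 1"
          "l * dist p p' * norm (snd b) \<le> l * dist p p' * 1"
        using l by (intro mult_left_mono; simp)+
      moreover have "x - fst y = (l * dist p p') *\<^sub>R fst b" "v - snd y = (l * dist p p') *\<^sub>R snd b"
        using y(1) by (cases y; cases b; simp)+
      ultimately have "norm (x - fst y) \<le> l * dist p p'" "norm (v - snd y) \<le> l * dist p p'"
        using l by simp_all
      moreover have "snd y \<in> subdiff_x g (fst y) p'" using y(2) by (auto simp: gph_def)
      ultimately show "\<exists>x' v'. v' \<in> subdiff_x g x' p' \<and>
        norm (x - x') \<le> l * dist p p' \<and> norm (v - v') \<le> l * dist p p'" by blast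
    qed
  qed
  then show thesis using that l by blast
qed

lemma lipschitz_near_uniformly:
  assumes "lipschitz_near f x0 p0 q0"
  obtains L where "L > 0" "eventually (\<lambda>\<alpha>. \<forall>x1\<in>ball x0 \<alpha>. \<forall>x2\<in>ball x0 \<alpha>.
      \<forall>p1\<in>ball p0 \<alpha>. \<forall>p2\<in>ball p0 \<alpha>. \<forall>q1\<in>ball q0 \<alpha>. \<forall>q2\<in>ball q0 \<alpha>.
        norm (f x1 p1 q1 - f x2 p2 q2) \<le> L * (norm (x1 - x2) + dist p1 p2 + dist q1 q2)) (at_right 0)"
proof -
  obtain L U P Q where "L > 0" and UPQ: "open U" "x0 \<in> U" "open P" "p0 \<in> P" "open Q" "q0 \<in> Q"
    and lip: "\<forall>x1\<in>U. \<forall>x2\<in>U. \<forall>p1\<in>P. \<forall>p2\<in>P. \<forall>q1\<in>Q. \<forall>q2\<in>Q.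
        norm (f x1 p1 q1 - f x2 p2 q2) \<le> L * (norm (x1 - x2) + dist p1 p2 + dist q1 q2)"
    using assms unfolding lipschitz_near_def by blast
  have "eventually (\<lambda>\<alpha>. ball x0 \<alpha> \<subseteq> U) (at_right 0)" "eventually (\<lambda>\<alpha>. ball p0 \<alpha> \<subseteq> P) (at_right 0)"
    "eventually (\<lambda>\<alpha>. ball q0 \<alpha> \<subseteq> Q) (at_right 0)"
    by (intro eventually_ball_radius UPQ)+
  then have "eventually (\<lambda>\<alpha>. ball x0 \<alpha> \<subseteq> U \<and> ball p0 \<alpha> \<subseteq> P \<and> ball q0 \<alpha> \<subseteq> Q) (at_right 0)"
    by (intro eventually_conj)
  then show thesis
    by (rule that[OF \<open>L > 0\<close> eventually_mono]) (intro ballI, use lip in blast)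
qed

lemma locally_strongly_monotone_uniformly:
  assumes "locally_strongly_monotone f x0 p0 q0 \<sigma>"
  shows "eventually (\<lambda>\<alpha>. \<forall>x1\<in>ball x0 \<alpha>. \<forall>x2\<in>ball x0 \<alpha>. \<forall>p\<in>ball p0 \<alpha>. \<forall>q\<in>ball q0 \<alpha>.
        (f x1 p q - f x2 p q) \<bullet> (x1 - x2) \<ge> \<sigma> * (norm (x1 - x2))\<^sup>2) (at_right 0)"
proof -
  obtain U P Q where UPQ: "open U" "x0 \<in> U" "open P" "p0 \<in> P" "open Q" "q0 \<in> Q"
    and mon: "\<forall>x1\<in>U. \<forall>x2\<in>U. \<forall>p\<in>P. \<forall>q\<in>Q.
        (f x1 p q - f x2 p q) \<bullet> (x1 - x2) \<ge> \<sigma> * (norm (x1 - x2))\<^sup>2"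
    using assms unfolding locally_strongly_monotone_def by blast
  have "eventually (\<lambda>\<alpha>. ball x0 \<alpha> \<subseteq> U) (at_right 0)" "eventually (\<lambda>\<alpha>. ball p0 \<alpha> \<subseteq> P) (at_right 0)"
    "eventually (\<lambda>\<alpha>. ball q0 \<alpha> \<subseteq> Q) (at_right 0)"
    by (intro eventually_ball_radius UPQ)+
  then have "eventually (\<lambda>\<alpha>. ball x0 \<alpha> \<subseteq> U \<and> ball p0 \<alpha> \<subseteq> P \<and> ball q0 \<alpha> \<subseteq> Q) (at_right 0)"
    by (intro eventually_conj)
  then show ?thesis
    by (rule eventually_mono) (intro ballI, use mon in blast)
qed

text \<open>The squared norms of the two sides differ by \<open>4\<kappa>(\<langle>v, x\<rangle> - \<kappa> \<parallel>x\<parallel>\<^sup>2)\<close>: the inequality of full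
  stability is strong monotonicity in disguise.\<close>

lemma norm_diff_scaleR_le_of_inner:
  fixes v x :: "'a::real_inner"
  assumes "\<kappa> \<ge> 0" "\<kappa> * (norm x)\<^sup>2 \<le> v \<bullet> x"
  shows "norm (v - (2 * \<kappa>) *\<^sub>R x) \<le> norm v"
proof (rule power2_le_imp_le)
  have "(norm (v - (2 * \<kappa>) *\<^sub>R x))\<^sup>2 = (norm v)\<^sup>2 - 4 * \<kappa> * (v \<bullet> x - \<kappa> * (norm x)\<^sup>2)"
    by (simp only: power2_norm_eq_inner inner_diff_left inner_diff_right inner_scaleR_left
        inner_scaleR_right) (simp add: inner_commute power2_eq_square algebra_simps)
  also have "\<dots> \<le> (norm v)\<^sup>2" using assms by simp
  finally show "(norm (v - (2 * \<kappa>) *\<^sub>R x))\<^sup>2 \<le> (norm v)\<^sup>2" .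
qed simp


text \<open>Here \<open>(x', v')\<close> is a solution for the second parameters that approximates the solution
  \<open>(x1, v1)\<close> for the first ones.\<close>

lemma perturbed_monotone_estimate:
  fixes v1 v2 v' x1 x2 x' :: "'a::real_inner"
  assumes \<kappa>: "\<kappa> \<ge> 0" and mon: "\<kappa> * (norm (x' - x2))\<^sup>2 \<le> (v' - v2) \<bullet> (x' - x2)"
    and x: "norm (x1 - x') \<le> a" and v: "norm (v1 - v') \<le> b"
  shows "norm ((v1 - v2) - (2 * \<kappa>) *\<^sub>R (x1 - x2)) \<le> norm (v1 - v2) + (2 * b + 2 * \<kappa> * a)"
proof -
  have "(v1 - v2) - (2 * \<kappa>) *\<^sub>R (x1 - x2)
      = ((v' - v2) - (2 * \<kappa>) *\<^sub>R (x' - x2)) + ((v1 - v') - (2 * \<kappa>) *\<^sub>R (x1 - x'))"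
    by (simp add: algebra_simps)
  then have "norm ((v1 - v2) - (2 * \<kappa>) *\<^sub>R (x1 - x2))
      \<le> norm ((v' - v2) - (2 * \<kappa>) *\<^sub>R (x' - x2)) + norm ((v1 - v') - (2 * \<kappa>) *\<^sub>R (x1 - x'))"
    by (metis norm_triangle_ineq)
  also have "norm ((v' - v2) - (2 * \<kappa>) *\<^sub>R (x' - x2)) \<le> norm (v' - v2)"
    by (rule norm_diff_scaleR_le_of_inner[OF \<kappa> mon])
  also have "norm (v' - v2) \<le> norm (v1 - v2) + norm (v1 - v')"
    using norm_triangle_ineq4[of "v1 - v2" "v1 - v'"] by simp
  also have "norm ((v1 - v') - (2 * \<kappa>) *\<^sub>R (x1 - x')) \<le> norm (v1 - v') + 2 * \<kappa> * norm (x1 - x')"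
    using norm_triangle_ineq4[of "v1 - v'" "(2 * \<kappa>) *\<^sub>R (x1 - x')"] \<kappa> by simp
  also have "2 * \<kappa> * norm (x1 - x') \<le> 2 * \<kappa> * a"
    using x \<kappa> by (intro mult_left_mono) auto
  finally show ?thesis using v by simp
qed

lemma single_valued_localizationI:
  assumes "\<And>a. a \<in> A \<Longrightarrow> \<theta> a \<in> B \<and> \<theta> a \<in> F a"
    and "\<And>a b. a \<in> A \<Longrightarrow> b \<in> B \<Longrightarrow> b \<in> F a \<Longrightarrow> b = \<theta> a"
  shows "single_valued_localization F A B \<theta>"
  unfolding single_valued_localization_def
proof (intro equalityI subsetI)
  fix t assume "t \<in> (\<lambda>a. (a, \<theta> a)) ` A"
  then obtain a where "t = (a, \<theta> a)" "a \<in> A" by blast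
  then show "t \<in> gph F \<inter> A \<times> B" using assms(1) by (simp add: gph_def)
next
  fix t assume "t \<in> gph F \<inter> A \<times> B"
  then obtain a b where t: "t = (a, b)" "a \<in> A" "b \<in> B" "b \<in> F a" by (auto simp: gph_def)
  then have "b = \<theta> a" by (intro assms(2))
  then show "t \<in> (\<lambda>a. (a, \<theta> a)) ` A" using t(1,2) by simp
qed

lemma mem_solution_map_iff:
  "x \<in> solution_map f g (v, p, q) \<longleftrightarrow> v - f x p q \<in> subdiff_x g x p"
proof -
  have "v \<in> (\<lambda>w. f x p q + w) ` B \<longleftrightarrow> v - f x p q \<in> B" for B
    by (force simp: image_iff)
  then show ?thesis by (simp add: solution_map_def)
qed

theorem theorem7p5:
  fixes f :: "'x::{real_inner, complete_space} \<Rightarrow> 'p::metric_space \<Rightarrow> 'q::metric_space \<Rightarrow> 'x"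
    and g :: "'x \<Rightarrow> 'p \<Rightarrow> ereal"
    and xbar vbar vhat :: 'x and pbar :: 'p and qbar :: 'q and \<sigma> :: real
  assumes g_not_minf: "\<And>x p. g x p \<noteq> -\<infinity>"
    and g_lsc: "lower_semicontinuous (\<lambda>(x, p). g x p)"
    and sol: "xbar \<in> solution_map f g (vbar, pbar, qbar)"
    and vhat: "vhat = vbar - f xbar pbar qbar"
    and A1: "lipschitz_near f xbar pbar qbar"
    and A2: "param_cont_prox_regular g xbar pbar vhat"
    and A3: "lipschitz_like (\<lambda>p. epi (\<lambda>x. g x p)) pbar (xbar, real_of_ereal (g xbar pbar))"
    and mono: "locally_strongly_monotone f xbar pbar qbar \<sigma>"
    and modulus: "\<sigma> > prox_threshold g xbar pbar vhat"
    and K_lip: "lipschitz_like (\<lambda>p. gph (\<lambda>x. subdiff_x g x p)) pbar (xbar, vhat)"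
  shows "lipschitzian_fully_stable f g xbar vbar pbar qbar"
proof -
  obtain r where r: "0 < r" "r < \<sigma>" and prr: "prox_regular_with g xbar pbar vhat r"
    using prox_threshold_less_witness[OF A2 modulus] by blast
  have vhat_sub: "vhat \<in> subdiff_x g xbar pbar"
    using sol by (simp add: mem_solution_map_iff vhat)
  have cl: "closed (epi (\<lambda>x. g x p))" for p
    by (rule closed_epi_section[OF g_lsc])

  have ev_pr: "eventually (\<lambda>\<alpha>. \<forall>p\<in>ball pbar \<alpha>.
      prox_regular_on (\<lambda>x. g x p) (ball xbar \<alpha>) (ball vhat \<alpha>) r) (at_right 0)"
    using A2 prox_regular_on_uniformly[OF prr g_not_minf _ vhat_sub]
    by (simp add: param_cont_prox_regular_def)
  obtain l where l: "l > 0" and ev_K: "eventually (\<lambda>\<alpha>. \<forall>p\<in>ball pbar \<alpha>. \<forall>p'\<in>ball pbar \<alpha>.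
      \<forall>x\<in>ball xbar \<alpha>. \<forall>v\<in>ball vhat \<alpha> \<inter> subdiff_x g x p. \<exists>x' v'. v' \<in> subdiff_x g x' p' \<and>
        norm (x - x') \<le> l * dist p p' \<and> norm (v - v') \<le> l * dist p p') (at_right 0)"
    using lipschitz_like_subdiff_gph[OF K_lip] by blast
  obtain L where L: "L > 0" and ev_L: "eventually (\<lambda>\<alpha>. \<forall>x1\<in>ball xbar \<alpha>. \<forall>x2\<in>ball xbar \<alpha>.
      \<forall>p1\<in>ball pbar \<alpha>. \<forall>p2\<in>ball pbar \<alpha>. \<forall>q1\<in>ball qbar \<alpha>. \<forall>q2\<in>ball qbar \<alpha>.
        norm (f x1 p1 q1 - f x2 p2 q2) \<le> L * (norm (x1 - x2) + dist p1 p2 + dist q1 q2)) (at_right 0)"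
    using lipschitz_near_uniformly[OF A1] by blast
  note ev_f = locally_strongly_monotone_uniformly[OF mono]
  obtain \<alpha> where \<alpha>: "(0::real) < \<alpha>"
    and pr: "\<forall>p\<in>ball pbar \<alpha>. prox_regular_on (\<lambda>x. g x p) (ball xbar \<alpha>) (ball vhat \<alpha>) r"
    and K: "\<forall>p\<in>ball pbar \<alpha>. \<forall>p'\<in>ball pbar \<alpha>.
      \<forall>x\<in>ball xbar \<alpha>. \<forall>v\<in>ball vhat \<alpha> \<inter> subdiff_x g x p. \<exists>x' v'. v' \<in> subdiff_x g x' p' \<and>
        norm (x - x') \<le> l * dist p p' \<and> norm (v - v') \<le> l * dist p p'"
    and lip: "\<forall>x1\<in>ball xbar \<alpha>. \<forall>x2\<in>ball xbar \<alpha>.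
      \<forall>p1\<in>ball pbar \<alpha>. \<forall>p2\<in>ball pbar \<alpha>. \<forall>q1\<in>ball qbar \<alpha>. \<forall>q2\<in>ball qbar \<alpha>.
        norm (f x1 p1 q1 - f x2 p2 q2) \<le> L * (norm (x1 - x2) + dist p1 p2 + dist q1 q2)"
    and fmon: "\<forall>x1\<in>ball xbar \<alpha>. \<forall>x2\<in>ball xbar \<alpha>. \<forall>p\<in>ball pbar \<alpha>. \<forall>q\<in>ball qbar \<alpha>.
        (f x1 p q - f x2 p q) \<bullet> (x1 - x2) \<ge> \<sigma> * (norm (x1 - x2))\<^sup>2"
    using eventually_happens'[OF trivial_limit_at_right_real
        eventually_conj[OF eventually_at_right_less[of 0]
          eventually_conj[OF ev_pr eventually_conj[OF ev_K eventually_conj[OF ev_L ev_f]]]]]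
    by (elim exE conjE) (rule that)

  obtain \<mu> c where \<mu>: "r < \<mu>" and c: "0 \<le> c" "c < \<mu> - r" "\<mu>\<^sup>2 - 2 * \<mu> * \<sigma> + L\<^sup>2 \<le> c\<^sup>2"
    using forward_step_constants[OF r] by blast
  \<comment> \<open>The radii are chosen from large to small. Solutions are sought within \<open>\<eta>\<close> of \<open>xbar\<close>: then the
    subgradients \<open>v - f(x, p, q)\<close>, and the graph points to which \<open>K\<close> moves them, stay within \<open>\<alpha>\<close>
    of \<open>(xbar, vhat)\<close>. The fixed point argument runs on balls of radius \<open>\<omega>\<close> around the points \<open>x\<^sub>p\<close>
    and tolerates an error \<open>\<tau>\<close> in the right-hand side; \<open>\<beta>\<close> is the radius for \<open>v\<close>, \<open>p\<close> and \<open>q\<close>.\<close>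
  define \<kappa> where "\<kappa> = \<sigma> - r"
  have \<kappa>: "\<kappa> > 0" using r by (simp add: \<kappa>_def)
  define \<eta> where "\<eta> = \<alpha> / (2 * (1 + 3 * L + 2 * l))"
  have \<eta>: "\<eta> > 0" using \<alpha> L l by (simp add: \<eta>_def)
  have \<eta>\<alpha>: "\<eta> + 3 * (L * \<eta>) + 2 * (l * \<eta>) = \<alpha> / 2"
  proof -
    have "\<eta> * (1 + 3 * L + 2 * l) = \<alpha> / 2" using L l by (simp add: \<eta>_def field_simps)
    then show ?thesis by (simp add: algebra_simps)
  qed
  have L\<eta>: "L * \<eta> > 0" and l\<eta>: "l * \<eta> > 0" using L l \<eta> by simp_all
  define \<omega> where "\<omega> = \<eta> / (2 * (1 + 3 * \<mu>))"
  have \<omega>: "\<omega> > 0" using \<eta> \<mu> r by (simp add: \<omega>_def)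
  have \<omega>\<eta>: "\<omega> + 3 * \<mu> * \<omega> = \<eta> / 2"
  proof -
    have "\<omega> * (1 + 3 * \<mu>) = \<eta> / 2" using \<mu> r by (simp add: \<omega>_def field_simps)
    then show ?thesis by (simp add: algebra_simps)
  qed
  have \<mu>\<omega>: "\<mu> * \<omega> > 0" and r\<omega>: "r * \<omega> > 0" using \<mu> r \<omega> by simp_all
  define \<tau> where "\<tau> = (\<mu> - r - c) * \<omega>"
  have \<tau>: "\<tau> > 0" using c \<omega> by (simp add: \<tau>_def)
  define \<beta> where "\<beta> = min (\<eta> / (2 * (1 + l))) (\<tau> / (1 + l + L * l + 2 * L))"
  have den: "0 < 1 + l + L * l + 2 * L" using L l by (simp add: add_pos_pos)
  have \<beta>: "\<beta> > 0" using \<eta> \<tau> l den by (simp add: \<beta>_def)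
  have "\<beta> \<le> \<eta> / (2 * (1 + l))" "\<beta> \<le> \<tau> / (1 + l + L * l + 2 * L)" by (simp_all add: \<beta>_def)
  then have "\<beta> * (2 * (1 + l)) \<le> \<eta>" "\<beta> * (1 + l + L * l + 2 * L) \<le> \<tau>"
    using l den by (simp_all add: pos_le_divide_eq)
  then have \<beta>\<eta>: "\<beta> + l * \<beta> \<le> \<eta> / 2" and \<beta>\<tau>: "\<beta> + l * \<beta> + L * (l * \<beta> + \<beta> + \<beta>) \<le> \<tau>"
    by (simp_all add: algebra_simps)
  have l\<beta>: "l * \<beta> > 0" using l \<beta> by simp
  have balls: "ball pbar \<beta> \<subseteq> ball pbar \<alpha>" "ball qbar \<beta> \<subseteq> ball qbar \<alpha>" "ball xbar \<eta> \<subseteq> ball xbar \<alpha>"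
    using \<beta>\<eta> \<eta>\<alpha> \<eta> L\<eta> l\<eta> l\<beta> \<alpha> by (intro subset_ball; linarith)+
  let ?S = "solution_map f g"

  have near: "norm ((v - f x p q) - vhat) < \<alpha> / 2 - 2 * (l * \<eta>)"
    if "v \<in> ball vbar \<beta>" "p \<in> ball pbar \<beta>" "q \<in> ball qbar \<beta>" "x \<in> ball xbar \<eta>" for v p q x
  proof -
    have "norm (f xbar pbar qbar - f x p q) \<le> L * (norm (xbar - x) + dist pbar p + dist qbar q)"
    proof -
      have "p \<in> ball pbar \<alpha>" "q \<in> ball qbar \<alpha>" "x \<in> ball xbar \<alpha>" using that balls by blast+
      then show ?thesis using lip \<alpha> by simp
    qed
    also have "\<dots> \<le> L * (\<eta> + \<eta> + \<eta>)"
      using that \<beta>\<eta> l\<beta> \<eta> L by (intro mult_left_mono) (auto simp: dist_norm)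
    finally have "norm (f xbar pbar qbar - f x p q) \<le> 3 * (L * \<eta>)" by simp
    moreover have "norm (v - vbar) < \<eta>"
      using that(1) \<beta>\<eta> l\<beta> \<eta> by (simp add: dist_norm norm_minus_commute)
    ultimately have "norm ((v - vbar) + (f xbar pbar qbar - f x p q)) < \<alpha> / 2 - 2 * (l * \<eta>)"
      using norm_triangle_ineq[of "v - vbar" "f xbar pbar qbar - f x p q"] \<eta>\<alpha> by linarith
    then show ?thesis by (simp add: vhat algebra_simps)
  qed

  have monotone: "\<kappa> * (norm (x1 - x2))\<^sup>2 \<le> ((w1 + f x1 p q) - (w2 + f x2 p q)) \<bullet> (x1 - x2)"
    if "p \<in> ball pbar \<alpha>" "q \<in> ball qbar \<alpha>"
      and 1: "x1 \<in> ball xbar \<alpha>" "w1 \<in> subdiff_x g x1 p" "w1 \<in> ball vhat \<alpha>"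
      and 2: "x2 \<in> ball xbar \<alpha>" "w2 \<in> subdiff_x g x2 p" "w2 \<in> ball vhat \<alpha>" for p q x1 x2 w1 w2
  proof -
    have "- r * (norm (x1 - x2))\<^sup>2 \<le> (w1 - w2) \<bullet> (x1 - x2)"
      by (rule prox_regular_on_hypomonotone[where \<phi> = "\<lambda>x. g x p", OF g_not_minf
            pr[rule_format, OF that(1)] 1(1) 1(2)[unfolded subdiff_x_def] 1(3)
            2(1) 2(2)[unfolded subdiff_x_def] 2(3)])
    moreover have "\<sigma> * (norm (x1 - x2))\<^sup>2 \<le> (f x1 p q - f x2 p q) \<bullet> (x1 - x2)"
      by (rule fmon[rule_format, OF 1(1) 2(1) that(1,2)])
    moreover have "(w1 + f x1 p q) - (w2 + f x2 p q) = (w1 - w2) + (f x1 p q - f x2 p q)" by simp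
    ultimately show ?thesis
      by (simp only: inner_add_left \<kappa>_def left_diff_distrib)
  qed

  define m where "m = 2 * (l + L * (l + 1)) + 2 * \<kappa> * l"
  have m: "m > 0" using l L \<kappa> by (simp add: m_def add_pos_pos)
  have estimate: "norm ((v1 - v2) - (2 * \<kappa>) *\<^sub>R (x1 - x2)) \<le> norm (v1 - v2) + m * (dist p1 p2 + dist q1 q2)"
    if v: "v1 \<in> ball vbar \<beta>" "v2 \<in> ball vbar \<beta>" and p: "p1 \<in> ball pbar \<beta>" "p2 \<in> ball pbar \<beta>"
      and q: "q1 \<in> ball qbar \<beta>" "q2 \<in> ball qbar \<beta>" and x: "x1 \<in> ball xbar \<eta>" "x2 \<in> ball xbar \<eta>"
      and S: "x1 \<in> ?S (v1, p1, q1)" "x2 \<in> ?S (v2, p2, q2)" for v1 v2 p1 p2 q1 q2 x1 x2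
  proof -
    define d where "d = dist p1 p2 + dist q1 q2"
    have d: "dist p1 p2 \<le> d" "0 \<le> d" by (simp_all add: d_def)
    have ld: "l * dist p1 p2 \<le> l * d" using d l by simp
    have "dist p1 p2 \<le> 2 * \<eta>"
      using p dist_triangle3[of p1 p2 pbar] \<beta>\<eta> l\<beta> \<eta> by simp
    then have l2: "l * dist p1 p2 \<le> 2 * (l * \<eta>)"
      using mult_left_mono[of "dist p1 p2" "2 * \<eta>" l] l by simp
    have pq: "p1 \<in> ball pbar \<alpha>" "p2 \<in> ball pbar \<alpha>" "q1 \<in> ball qbar \<alpha>" "q2 \<in> ball qbar \<alpha>"
      "x1 \<in> ball xbar \<alpha>" "x2 \<in> ball xbar \<alpha>"
      using p q x balls by blast+
    define w1 where "w1 = v1 - f x1 p1 q1"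
    define w2 where "w2 = v2 - f x2 p2 q2"
    have w: "w1 \<in> subdiff_x g x1 p1" "w2 \<in> subdiff_x g x2 p2"
      using S by (simp_all add: mem_solution_map_iff w1_def w2_def)
    have w1n: "norm (w1 - vhat) < \<alpha> / 2 - 2 * (l * \<eta>)" and w2n: "norm (w2 - vhat) < \<alpha> / 2 - 2 * (l * \<eta>)"
      using near v p q x by (simp_all add: w1_def w2_def)
    have wb: "w1 \<in> ball vhat \<alpha>" "w2 \<in> ball vhat \<alpha>"
      using w1n w2n \<alpha> l\<eta> by (simp_all add: dist_norm norm_minus_commute)
    obtain x' w' where x': "w' \<in> subdiff_x g x' p2" "norm (x1 - x') \<le> l * dist p1 p2"
        "norm (w1 - w') \<le> l * dist p1 p2"
      using K[rule_format, OF pq(1,2,5) IntI[OF wb(1) w(1)]] by blast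
    have x'b: "x' \<in> ball xbar \<alpha>"
    proof -
      have "norm (xbar - x') \<le> norm (xbar - x1) + norm (x1 - x')"
        using norm_triangle_ineq[of "xbar - x1" "x1 - x'"] by simp
      then show ?thesis
        using x(1) x'(2) l2 \<eta>\<alpha> L\<eta> \<alpha> by (simp add: dist_norm)
    qed
    have w'b: "w' \<in> ball vhat \<alpha>"
    proof -
      have "norm (vhat - w') \<le> norm (w1 - vhat) + norm (w1 - w')"
        using norm_triangle_ineq4[of "w1 - w'" "w1 - vhat"] by (simp add: norm_minus_commute)
      then show ?thesis
        using w1n x'(3) l2 \<alpha> by (simp add: dist_norm)
    qed
    \<comment> \<open>By construction \<open>x'\<close> solves the equation for \<open>(v', p2, q2)\<close>.\<close>
    define v' where "v' = w' + f x' p2 q2"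
    have fl: "norm (f x1 p1 q1 - f x' p2 q2) \<le> L * (norm (x1 - x') + dist p1 p2 + dist q1 q2)"
      by (rule lip[rule_format, OF pq(5) x'b pq(1-4)])
    also have "\<dots> \<le> L * (l * d + d)"
      using x'(2) ld L by (intro mult_left_mono) (auto simp: d_def)
    finally have "norm (f x1 p1 q1 - f x' p2 q2) \<le> L * (l + 1) * d" by (simp add: algebra_simps)
    then have "norm ((w1 - w') + (f x1 p1 q1 - f x' p2 q2)) \<le> l * d + L * (l + 1) * d"
      using norm_triangle_ineq[of "w1 - w'" "f x1 p1 q1 - f x' p2 q2"] x'(3) ld by linarith
    moreover have "v1 - v' = (w1 - w') + (f x1 p1 q1 - f x' p2 q2)"
      by (simp add: w1_def v'_def)
    ultimately have v1v': "norm (v1 - v') \<le> l * d + L * (l + 1) * d" by metis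
    have "\<kappa> * (norm (x' - x2))\<^sup>2 \<le> ((w' + f x' p2 q2) - (w2 + f x2 p2 q2)) \<bullet> (x' - x2)"
      by (rule monotone[OF pq(2,4) x'b x'(1) w'b pq(6) w(2) wb(2)])
    then have "\<kappa> * (norm (x' - x2))\<^sup>2 \<le> (v' - v2) \<bullet> (x' - x2)"
      by (simp add: v'_def w2_def)
    from perturbed_monotone_estimate[OF less_imp_le[OF \<kappa>] this _ v1v', of x1 "l * d"]
    have "norm ((v1 - v2) - (2 * \<kappa>) *\<^sub>R (x1 - x2))
        \<le> norm (v1 - v2) + (2 * (l * d + L * (l + 1) * d) + 2 * \<kappa> * (l * d))"
      using x'(2) ld by linarith
    also have "2 * (l * d + L * (l + 1) * d) + 2 * \<kappa> * (l * d) = m * d"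
      by (simp add: m_def algebra_simps)
    finally show ?thesis by (simp add: d_def)
  qed

  have existence: "\<exists>x. x \<in> ball xbar \<eta> \<and> x \<in> ?S (v, p, q)"
    if v: "v \<in> ball vbar \<beta>" and p: "p \<in> ball pbar \<beta>" and q: "q \<in> ball qbar \<beta>" for v p q
  proof -
    have pq: "p \<in> ball pbar \<alpha>" "q \<in> ball qbar \<alpha>" "pbar \<in> ball pbar \<alpha>" "qbar \<in> ball qbar \<alpha>"
      "xbar \<in> ball xbar \<alpha>" "vhat \<in> ball vhat \<alpha>"
      using p q balls \<alpha> by auto
    obtain xp vp where xp: "vp \<in> subdiff_x g xp p" and n: "norm (xbar - xp) \<le> l * dist pbar p"
        "norm (vhat - vp) \<le> l * dist pbar p"
      using K[rule_format, OF pq(3,1,5) IntI[OF pq(6) vhat_sub]] by blast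
    have "l * dist pbar p \<le> l * \<beta>" using p l by simp
    then have n\<beta>: "norm (xbar - xp) \<le> l * \<beta>" "norm (vhat - vp) \<le> l * \<beta>"
      using n by linarith+
    then have n2: "dist xbar xp \<le> \<eta> / 2 - \<beta>" "dist vhat vp \<le> \<eta> / 2 - \<beta>"
      using \<beta>\<eta> by (simp_all add: dist_norm)
    have \<eta>\<alpha>2: "\<eta> \<le> \<alpha> / 2" using \<eta>\<alpha> L\<eta> l\<eta> by linarith
    have sub: "cball xp (\<alpha> / 2) \<subseteq> ball xbar \<alpha>" "cball vp (\<alpha> / 2) \<subseteq> ball vhat \<alpha>"
    proof -
      have "dist xbar y < \<alpha>" if "dist xp y \<le> \<alpha> / 2" for y
        using dist_triangle[of xbar y xp] n2(1) that \<eta>\<alpha>2 \<alpha> \<beta> by linarith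
      then show "cball xp (\<alpha> / 2) \<subseteq> ball xbar \<alpha>" by auto
      have "dist vhat y < \<alpha>" if "dist vp y \<le> \<alpha> / 2" for y
        using dist_triangle[of vhat y vp] n2(2) that \<eta>\<alpha>2 \<alpha> \<beta> by linarith
      then show "cball vp (\<alpha> / 2) \<subseteq> ball vhat \<alpha>" by auto
    qed
    have prp: "prox_regular_on (\<lambda>x. g x p) (cball xp (\<alpha> / 2)) (cball vp (\<alpha> / 2)) r"
      using prox_regular_on_subset[OF _ sub] pr pq(1) by blast
    have xpb: "xp \<in> ball xbar \<alpha>" using subsetD[OF sub(1), of xp] \<alpha> by simp
    have v_near: "norm (v - (vp + f xp p q)) \<le> \<tau>"
    proof -
      have "norm (f xbar pbar qbar - f xp p q) \<le> L * (norm (xbar - xp) + dist pbar p + dist qbar q)"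
        by (rule lip[rule_format, OF pq(5) xpb pq(3,1,4,2)])
      also have "\<dots> \<le> L * (l * \<beta> + \<beta> + \<beta>)"
        using n\<beta> p q L by (intro mult_left_mono) auto
      finally have 1: "norm (f xbar pbar qbar - f xp p q) \<le> L * (l * \<beta> + \<beta> + \<beta>)" .
      have eq: "v - (vp + f xp p q) = (v - vbar) + ((vhat - vp) + (f xbar pbar qbar - f xp p q))"
        by (simp add: vhat)
      have "norm (v - (vp + f xp p q))
          \<le> norm (v - vbar) + (norm (vhat - vp) + norm (f xbar pbar qbar - f xp p q))"
        unfolding eq
        using norm_triangle_ineq[of "v - vbar" "(vhat - vp) + (f xbar pbar qbar - f xp p q)"]
          norm_triangle_ineq[of "vhat - vp" "f xbar pbar qbar - f xp p q"] by linarith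
      also have "\<dots> \<le> \<beta> + (l * \<beta> + L * (l * \<beta> + \<beta> + \<beta>))"
        using v n\<beta>(2) 1 by (intro add_mono) (auto simp: dist_norm norm_minus_commute)
      finally show ?thesis using \<beta>\<tau> by linarith
    qed
    have fx: "norm (f x p q - f y p q) \<le> L * norm (x - y)"
        "(f x p q - f y p q) \<bullet> (x - y) \<ge> \<sigma> * (norm (x - y))\<^sup>2"
      if "x \<in> cball xp (\<alpha> / 2)" "y \<in> cball xp (\<alpha> / 2)" for x y
    proof -
      have xy: "x \<in> ball xbar \<alpha>" "y \<in> ball xbar \<alpha>" using that sub(1) by blast+
      have "norm (f x p q - f y p q) \<le> L * (norm (x - y) + dist p p + dist q q)"
        by (rule lip[rule_format, OF xy pq(1,1,2,2)])
      then show "norm (f x p q - f y p q) \<le> L * norm (x - y)" by simp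
      show "(f x p q - f y p q) \<bullet> (x - y) \<ge> \<sigma> * (norm (x - y))\<^sup>2"
        by (rule fmon[rule_format, OF xy pq(1,2)])
    qed
    have \<omega>2: "2 * \<omega> < \<alpha> / 2" "(3 * \<mu> - r) * \<omega> < \<alpha> / 2"
      using \<omega>\<eta> \<omega> \<mu>\<omega> r\<omega> \<eta>\<alpha>2 \<eta> by (simp_all add: left_diff_distrib)
    \<comment> \<open>\<open>(xp, vp)\<close> serves as the centre: the balls of radius \<open>\<alpha> / 2\<close> around it have the same size for
      all \<open>p\<close>.\<close>
    have half: "\<alpha> / 2 > 0" using \<alpha> by simp
    obtain x where x: "x \<in> cball xp \<omega>" "v - f x p q \<in> limiting_subdiff (\<lambda>x. g x p) x"
      using generalized_equation_solvable[where \<phi> = "\<lambda>x. g x p" and h = "\<lambda>x. f x p q",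
          OF g_not_minf cl prp xp[unfolded subdiff_x_def] half half r(1) \<mu> less_imp_le[OF \<omega>]
            \<omega>2 fx c v_near[unfolded \<tau>_def]]
      by blast
    have "dist xbar x < \<eta>"
      using dist_triangle[of xbar x xp] x(1) n2(1) \<omega>\<eta> \<mu>\<omega> \<beta> by simp
    then show ?thesis
      using x(2) by (auto simp: mem_solution_map_iff subdiff_x_def)
  qed

  define \<theta> where "\<theta> a = (SOME x. x \<in> ball xbar \<eta> \<and> x \<in> ?S a)" for a
  have \<theta>: "\<theta> (v, p, q) \<in> ball xbar \<eta>" "\<theta> (v, p, q) \<in> ?S (v, p, q)"
    if "v \<in> ball vbar \<beta>" "p \<in> ball pbar \<beta>" "q \<in> ball qbar \<beta>" for v p q
    using someI_ex[OF existence[OF that]] unfolding \<theta>_def by blast+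
  have unique: "x = \<theta> (v, p, q)"
    if "v \<in> ball vbar \<beta>" "p \<in> ball pbar \<beta>" "q \<in> ball qbar \<beta>" "x \<in> ball xbar \<eta>" "x \<in> ?S (v, p, q)"
    for v p q x
    using estimate[OF that(1,1,2,2,3,3,4) \<theta>(1)[OF that(1-3)] that(5) \<theta>(2)[OF that(1-3)]] \<kappa>
    by (simp add: mult_le_0_iff)
  have "single_valued_localization ?S (ball vbar \<beta> \<times> ball pbar \<beta> \<times> ball qbar \<beta>) (ball xbar \<eta>) \<theta>"
    using \<theta> unique by (intro single_valued_localizationI) blast+
  moreover have "\<forall>v1\<in>ball vbar \<beta>. \<forall>v2\<in>ball vbar \<beta>. \<forall>p1\<in>ball pbar \<beta>. \<forall>p2\<in>ball pbar \<beta>.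
      \<forall>q1\<in>ball qbar \<beta>. \<forall>q2\<in>ball qbar \<beta>.
        norm ((v1 - v2) - (2 * \<kappa>) *\<^sub>R (\<theta> (v1, p1, q1) - \<theta> (v2, p2, q2)))
          \<le> norm (v1 - v2) + m * (dist p1 p2 + dist q1 q2)"
    by (intro ballI estimate \<theta>)
  ultimately have "\<exists>V P Q U \<theta>. open V \<and> vbar \<in> V \<and> open P \<and> pbar \<in> P \<and> open Q \<and> qbar \<in> Q \<and>
      open U \<and> xbar \<in> U \<and> single_valued_localization ?S (V \<times> P \<times> Q) U \<theta> \<and>
      (\<exists>\<kappa>>0. \<exists>l>0. \<forall>v1\<in>V. \<forall>v2\<in>V. \<forall>p1\<in>P. \<forall>p2\<in>P. \<forall>q1\<in>Q. \<forall>q2\<in>Q.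
        norm ((v1 - v2) - (2 * \<kappa>) *\<^sub>R (\<theta> (v1, p1, q1) - \<theta> (v2, p2, q2)))
          \<le> norm (v1 - v2) + l * (dist p1 p2 + dist q1 q2))"
    using \<beta> \<eta> \<kappa> m
    by (intro exI[of _ "ball vbar \<beta>"] exI[of _ "ball pbar \<beta>"] exI[of _ "ball qbar \<beta>"]
        exI[of _ "ball xbar \<eta>"] exI[of _ \<theta>] conjI exI[of _ \<kappa>] exI[of _ m]) simp_all
  then show ?thesis
    unfolding lipschitzian_fully_stable_def using sol by (simp add: gph_def)
qed

end
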